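(* Let $\boldsymbol X\in RV^d_+(2)$ with normalizing sequence $(b_n)$, let $\boldsymbol X_1,\dots,\boldsymbol X_n$ be i.i.d. copies of $\boldsymbol X$, let $R_\ell=\|\boldsymbol X_\ell\|_2$ and $\boldsymbol\omega_\ell=\boldsymbol X_\ell/R_\ell$, and let $F$ be the distribution function of $R=\|\boldsymbol X\|_2$, $\bar F=1-F$. Choose $k=k(n)$ such that $k=o(n)$ and $k\to\infty$ as $n\to\infty$. Let $f:\Theta_+^{d-1}\to\mathbb R_+$ be a continuous function. Assume that, with $\alpha=2$, $$\lim_{n\to\infty}\sqrt k\Big(\frac nk\,\mathbb E\big[f(\boldsymbol\omega_1)\mathbf 1\{R_1\ge b_{\lfloor n/k\rfloor}t^{-1/\alpha}\}\big]-\mathbb E_{\tilde H_{\boldsymbol X}}[f(\boldsymbol\omega_1)]\,\frac nk\,\bar F\big(b_{\lfloor n/k\rfloor}t^{-1/\alpha}\big)\Big)=0$$ holds locally uniformly for $t\in[0,\infty)$, and that $\mathrm{Var}_{\tilde H_{\boldsymbol X}}(f(\boldsymbol\omega))>0$. Then $$\sqrt k\big(\hat{\mathbb E}_{\tilde H_{\boldsymbol X}}[f(\boldsymbol\omega)]-\mathbb E_{\tilde H_{\boldsymbol X}}[f(\boldsymbol\omega)]\big)\xrightarrow{\ \mathcal D\ }N(0,\sigma^2),\qquad n\to\infty,$$ where $\sigma^2=\mathrm{Var}_{\tilde H_{\boldsymbol X}}(f(\boldsymbol\omega))$.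
   Context: $\Theta_+^{d-1}=\{\boldsymbol\omega\in\mathbb R_+^d:\|\boldsymbol\omega\|_2=1\}$. A random vector $\boldsymbol X\in\mathbb R^d_+$ is in $RV^d_+(2)$ if there are a sequence $b_n\to\infty$ and a finite measure $H_{\boldsymbol X}$ (spectral measure) on $\Theta_+^{d-1}$ such that, with $R=\|\boldsymbol X\|_2$ and $\boldsymbol\omega=\boldsymbol X/R$, $n\mathbb P[(R/b_n,\boldsymbol\omega)\in\cdot]\to\nu_2\times H_{\boldsymbol X}$ vaguely on $(0,\infty]\times\Theta_+^{d-1}$, where $d\nu_2(x)=2x^{-3}dx$. The normalized spectral measure is $\tilde H_{\boldsymbol X}=H_{\boldsymbol X}/H_{\boldsymbol X}(\Theta_+^{d-1})$, a probability measure; $\mathbb E_{\tilde H_{\boldsymbol X}}$ and $\mathrm{Var}_{\tilde H_{\boldsymbol X}}$ denote expectation and variance when $\boldsymbol\omega$ has distribution $\tilde H_{\boldsymbol X}$. With $R^{(k)}$ the $k$-th largest among $R_1,\dots,R_n$, the estimator is $$\hat{\mathbb E}_{\tilde H_{\boldsymbol X}}[f(\boldsymbol\omega)]=\frac1k\sum_{\ell=1}^nf(\boldsymbol\omega_\ell)\mathbf 1\{R_\ell\ge R^{(k)}\}.$$ *)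

theory Defs
  imports "HOL-Probability.Probability" "HOL-Library.Landau_Symbols"
begin

text \<open>On \<open>real ^ 'd\<close>, \<open>norm\<close> is the Euclidean norm.\<close>

definition nonneg_orthant :: "(real ^ 'd) set" where
  "nonneg_orthant = {x. \<forall>i. 0 \<le> x $ i}"

definition nonneg_sphere :: "(real ^ 'd) set" where
  "nonneg_sphere = {x \<in> nonneg_orthant. norm x = 1}"

text \<open>The angular part. For \<open>x = 0\<close> its value is \<open>0\<close>, which lies outside \<open>nonneg_sphere\<close>.\<close>

definition angle :: "real ^ 'd \<Rightarrow> real ^ 'd" where
  "angle x = x /\<^sub>R norm x"

text \<open>Vague convergence of Borel measures on a subspace \<open>E\<close>, tested against the continuous real
  functions on \<open>E\<close> with compact support in \<open>E\<close>.\<close>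

definition vague_conv_on ::
  "'a::t2_space set \<Rightarrow> (nat \<Rightarrow> 'a measure) \<Rightarrow> 'a measure \<Rightarrow> bool" where
  "vague_conv_on E \<mu> \<nu> \<longleftrightarrow>
     (\<forall>g :: 'a \<Rightarrow> real.
        continuous_on E g \<and> (\<exists>K. compact K \<and> K \<subseteq> E \<and> (\<forall>x\<in>E - K. g x = 0)) \<longrightarrow>
        (\<lambda>n. \<integral>x. g x \<partial>\<mu> n) \<longlonglongrightarrow> (\<integral>x. g x \<partial>\<nu>))"

text \<open>The space \<open>(0,\<infinity>] \<times> \<Theta>\<close>. The point \<open>\<infinity>\<close> is included, so that sets bounded away from \<open>0\<close> are
  relatively compact in the radial direction.\<close>

definition polar_space :: "(ereal \<times> (real ^ 'd)) set" where
  "polar_space = {0<..} \<times> nonneg_sphere"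

text \<open>The measure \<open>2 x\<^bsup>-3\<^esup> dx\<close>, viewed on \<open>(0,\<infinity>]\<close> with no mass at \<open>\<infinity>\<close>.\<close>

definition nu2 :: "ereal measure" where
  "nu2 = restrict_space
           (distr (density lborel (\<lambda>x. ennreal (2 * x powr (-3)) * indicator {0<..} x)) borel ereal)
           {0<..}"

text \<open>The restriction of \<open>n \<P>[(R / b\<^sub>n, \<omega>) \<in> \<cdot>]\<close> to \<open>(0,\<infinity>] \<times> \<Theta>\<close>; it discards the event \<open>R = 0\<close>.\<close>

definition scaled_polar_law ::
  "'w measure \<Rightarrow> ('w \<Rightarrow> real ^ 'd) \<Rightarrow> (nat \<Rightarrow> real) \<Rightarrow> nat \<Rightarrow> (ereal \<times> (real ^ 'd)) measure" where
  "scaled_polar_law M X b n =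
     scale_measure (of_nat n)
       (restrict_space
          (distr M borel (\<lambda>w. (ereal (norm (X w) / b n), angle (X w))))
          polar_space)"

text \<open>\<open>X\<close> is a random vector in \<open>RV\<^sup>d\<^sub>+(2)\<close> with normalizing sequence \<open>b\<close> and spectral measure \<open>H\<close>.\<close>

definition regularly_varying2 ::
  "'w measure \<Rightarrow> ('w \<Rightarrow> real ^ 'd) \<Rightarrow> (nat \<Rightarrow> real) \<Rightarrow> (real ^ 'd) measure \<Rightarrow> bool" where
  "regularly_varying2 M X b H \<longleftrightarrow>
     X \<in> M \<rightarrow>\<^sub>M restrict_space borel nonneg_orthant \<and>
     filterlim b at_top sequentially \<and>
     finite_measure H \<and> sets H = sets (restrict_space borel nonneg_sphere) \<and>
     vague_conv_on polar_space (scaled_polar_law M X b) (nu2 \<Otimes>\<^sub>M H)"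

text \<open>This is the null measure if \<open>H\<close> is null, and a probability measure for every other finite
  \<open>H\<close>.\<close>

definition normalized_spectral :: "'a measure \<Rightarrow> 'a measure" where
  "normalized_spectral H = scale_measure (1 / emeasure H (space H)) H"

definition spectral_mean :: "'a measure \<Rightarrow> ('a \<Rightarrow> real) \<Rightarrow> real" where
  "spectral_mean H f = prob_space.expectation (normalized_spectral H) f"

definition spectral_var :: "'a measure \<Rightarrow> ('a \<Rightarrow> real) \<Rightarrow> real" where
  "spectral_var H f = prob_space.variance (normalized_spectral H) f"

text \<open>The survival function \<open>1 - F\<close>, with extended real argument so that its value at \<open>\<infinity>\<close> makes
  sense.\<close>

definition survival :: "real measure \<Rightarrow> ereal \<Rightarrow> real" where
  "survival \<mu> x = 1 - measure \<mu> {r. ereal r \<le> x}"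

lemma survival_ereal: "survival \<mu> (ereal x) = 1 - cdf \<mu> x"
  by (simp add: survival_def cdf_def atMost_def)

lemma survival_infinity:
  assumes "prob_space \<mu>" "sets \<mu> = sets borel"
  shows "survival \<mu> \<infinity> = 0"
proof -
  have "space \<mu> = UNIV"
    using sets_eq_imp_space_eq[OF assms(2)] by simp
  then show ?thesis
    using prob_space.prob_space[OF assms(1)] by (simp add: survival_def)
qed

text \<open>The level \<open>b t\<^bsup>-1/2\<^esup>\<close> for \<open>t \<ge> 0\<close>, equal to \<open>\<infinity>\<close> at \<open>t = 0\<close> (whereas \<open>0 powr (-1/2) = 0\<close>).\<close>

definition level :: "real \<Rightarrow> real \<Rightarrow> ereal" where
  "level b t = (if t = 0 then \<infinity> else ereal (b * t powr (- 1 / 2)))"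

text \<open>The \<open>k\<close>-th largest entry, counted with multiplicity and starting from \<open>k = 1\<close>.\<close>

definition kth_largest :: "nat \<Rightarrow> real list \<Rightarrow> real" where
  "kth_largest k xs = rev (sort xs) ! (k - 1)"

definition spectral_mean_estimator ::
  "(real ^ 'd \<Rightarrow> real) \<Rightarrow> nat \<Rightarrow> nat \<Rightarrow> (nat \<Rightarrow> real ^ 'd) \<Rightarrow> real" where
  "spectral_mean_estimator f k n x =
     1 / real k *
     (\<Sum>l=1..n. f (angle (x l)) *
        of_bool (norm (x l) \<ge> kth_largest k (map (\<lambda>j. norm (x j)) [1..<n + 1])))"

end

theory Submission
  imports Defs
begin

text \<open>Write \<open>\<psi> = f(\<omega>) - c\<close> with \<open>c\<close> the spectral mean. At a deterministic level \<open>x\<close> the sum of \<open>\<psi>\<close>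
  over the exceedances of \<open>x\<close>, divided by \<open>sqrt k\<close>, is a row of bounded i.i.d. variables, so it is
  asymptotically normal once the expected number of exceedances is about \<open>k\<close>; the bias condition
  makes its mean vanish and regular variation identifies the variance. To replace the
  deterministic level by the \<open>k\<close>-th largest radius, take finitely many quantile levels whose
  expected numbers of exceedances are \<open>k + s sqrt k\<close>, with \<open>s\<close> in a fine grid of a long interval. With
  high probability \<open>k\<close> lies between the exceedance counts of two neighbouring levels. As \<open>f \<ge> 0\<close>,
  the sum of \<open>f\<close> over the largest observations is then squeezed between the sums at these two
  levels, and Chebyshev's inequality shows that all centred sums agree up to \<open>o(sqrt k)\<close>. Ties are
  harmless: the bias condition, taken at a level and at its left limit, forces the atoms of the
  radius to have mass \<open>o(sqrt k / n)\<close>.\<close>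

section \<open>Order statistics and exceedance counts\<close>

text \<open>Shifting the level so that the number of exceedances changes by order sqrt k changes the
  sum of \<open>f\<close> by the same order, so the random threshold cannot simply be replaced in
  that sum. Subtracting \<open>c\<close> per exceedance cancels the effect to first order, which is
  why the limit has the variance of \<open>f(\<omega>)\<close> and not its second moment. The
  centred summands change sign, however, so their sum is not monotone in the level. The squeeze must
  be done with \<open>f\<close> itself, and passing back to \<open>\<psi>\<close> costs
  \<open>c\<close> times the distance of the exceedance count from \<open>k\<close>; this cost fixes
  the mesh of the grid. Regular variation determines tail probabilities only to first order, so a
  level \<open>row_scale n * y\<close> with fixed \<open>y\<close> cannot be tuned to an expected
  count with precision sqrt k. Quantiles can, up to atoms, and regular variation only has to locate
  them near \<open>row_scale n * sqrt h\<close>. The bias condition pairs a weak inequality in the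
  mean of \<open>f\<close> with a strict one in the survival function; from this mismatch comes the
  bound on atoms, and it needs \<open>c > 0\<close>.\<close>

text \<open>In ascending order the entries that are at least \<open>x\<close> form a final segment.
  The lemma replaces sorting by counting, in which form both measurability and the squeeze are
  accessible.\<close>

lemma le_kth_largest_iff:
  assumes "1 \<le> k" "k \<le> length xs"
  shows "x \<le> kth_largest k xs \<longleftrightarrow> k \<le> length (filter (\<lambda>y. x \<le> y) xs)"
proof -
  define ys where "ys = sort xs"
  \<comment> \<open>Position of the \<open>k\<close>-th largest entry in ascending order, counted
    from 0: \<open>k\<close> indices lie at or after \<open>m\<close>, but only \<open>k - 1\<close>
    strictly after it.\<close>
  define m where "m = length xs - k"
  have len: "length ys = length xs" and sorted: "sorted ys"
    by (simp_all add: ys_def)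
  have kth: "kth_largest k xs = ys ! m"
    using assms by (simp add: kth_largest_def ys_def[symmetric] rev_nth len m_def)
  have "length (filter (\<lambda>y. x \<le> y) xs) = length (filter (\<lambda>y. x \<le> y) ys)"
    unfolding ys_def by (metis filter_sort length_sort)
  also have "\<dots> = card {i. i < length xs \<and> x \<le> ys ! i}"
    by (simp add: length_filter_conv_card len)
  finally have count: "length (filter (\<lambda>y. x \<le> y) xs) = card {i. i < length xs \<and> x \<le> ys ! i}" .
  show ?thesis
  proof
    assume "x \<le> kth_largest k xs"
    then have "{m..<length xs} \<subseteq> {i. i < length xs \<and> x \<le> ys ! i}"
      using sorted_nth_mono[OF sorted] by (fastforce simp: kth len intro: order_trans)
    then have "card {m..<length xs} \<le> card {i. i < length xs \<and> x \<le> ys ! i}"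
      by (intro card_mono) auto
    then show "k \<le> length (filter (\<lambda>y. x \<le> y) xs)"
      using assms by (simp add: count m_def)
  next
    assume *: "k \<le> length (filter (\<lambda>y. x \<le> y) xs)"
    show "x \<le> kth_largest k xs"
    proof (rule ccontr)
      assume "\<not> x \<le> kth_largest k xs"
      then have lt: "ys ! m < x" by (simp add: kth)
      have "{i. i < length xs \<and> x \<le> ys ! i} \<subseteq> {m<..<length xs}"
      proof
        fix i assume i: "i \<in> {i. i < length xs \<and> x \<le> ys ! i}"
        have "m < i"
        proof (rule ccontr)
          assume "\<not> m < i"
          then have "ys ! i \<le> ys ! m"
            using sorted assms by (intro sorted_nth_mono) (auto simp: len m_def)
          with lt i show False by simp
        qed
        with i show "i \<in> {m<..<length xs}" by simp
      qed
      then have "card {i. i < length xs \<and> x \<le> ys ! i} \<le> card {m<..<length xs}"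
        by (intro card_mono) auto
      then show False using * assms by (simp add: count m_def)
    qed
  qed
qed

definition exceedances :: "(nat \<Rightarrow> real) \<Rightarrow> nat \<Rightarrow> real \<Rightarrow> real" where
  "exceedances r n x = (\<Sum>l=1..n. of_bool (x \<le> r l))"

lemma exceedances_eq_length_filter:
  "exceedances r n x = real (length (filter (\<lambda>y. x \<le> y) (map r [1..<n + 1])))"
  by (induction n) (auto simp: exceedances_def)

lemma le_kth_largest_iff_exceedances:
  assumes "1 \<le> k" "k \<le> n"
  shows "x \<le> kth_largest k (map r [1..<n + 1]) \<longleftrightarrow> real k \<le> exceedances r n x"
  unfolding exceedances_eq_length_filter of_nat_le_iff
  using assms by (intro le_kth_largest_iff) simp_all

text \<open>Sums of nonnegative terms decrease as the level rises, and the count at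
  \<open>x'\<close> puts \<open>x'\<close> below the \<open>k\<close>-th largest value. The level
  \<open>x\<close> may also lie below that value; then its count is at most \<open>k\<close> while
  the count at the higher threshold is at least \<open>k\<close>, so both thresholds select the same
  indices. The sign of \<open>\<phi>\<close> is demanded only where \<open>r l\<close> is positive
  because \<open>f\<close> is not controlled at the angle of the origin.\<close>

lemma kth_largest_sum_sandwich:
  fixes r \<phi> :: "nat \<Rightarrow> real" and n :: nat
  defines "A \<equiv> \<lambda>x. \<Sum>l=1..n. \<phi> l * of_bool (x \<le> r l)"
  assumes k: "1 \<le> k" "k \<le> n"
    and \<phi>: "\<And>l. l \<in> {1..n} \<Longrightarrow> 0 < r l \<Longrightarrow> 0 \<le> \<phi> l"
    and pos: "0 < x'"
    and le: "exceedances r n x \<le> k" "k \<le> exceedances r n x'"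
  shows "A x \<le> A (kth_largest k (map r [1..<n + 1]))"
    and "A (kth_largest k (map r [1..<n + 1])) \<le> A x'"
proof -
  define K where "K = kth_largest k (map r [1..<n + 1])"
  have x'K: "x' \<le> K"
    using le_kth_largest_iff_exceedances[OF k] le(2) by (simp add: K_def del: upt_Suc)
  have K: "real k \<le> exceedances r n K"
    using le_kth_largest_iff_exceedances[OF k, of K r] by (simp add: K_def del: upt_Suc)
  have mono: "A y \<le> A z" if "z \<le> y" "0 < z" for y z
    unfolding A_def using that \<phi> by (intro sum_mono) (auto simp: of_bool_def)
  show "A K \<le> A x'" unfolding K_def[symmetric] using mono x'K pos by simp
  show "A x \<le> A K"
  proof (cases "K \<le> x")
    case True
    then show ?thesis using mono x'K pos by simp
  next
    case False
    have "(\<Sum>l=1..n. of_bool (x \<le> r l) - of_bool (K \<le> r l) :: real) \<le> 0"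
      using K le(1) by (simp add: exceedances_def sum_subtractf)
    moreover have "0 \<le> (of_bool (x \<le> r l) - of_bool (K \<le> r l) :: real)" for l
      using False by auto
    ultimately have "\<forall>l\<in>{1..n}. of_bool (x \<le> r l) - of_bool (K \<le> r l) = (0::real)"
      by (subst sum_nonneg_eq_0_iff[symmetric]) (auto intro!: antisym sum_nonneg)
    then have "A x = A K"
      unfolding A_def by (intro sum.cong refl) auto
    then show ?thesis by simp
  qed
qed

text \<open>A discrete intermediate value argument in which \<open>g\<close> may go up and down. It
  will be applied to exceedance counts along a grid of levels whose order is never
  established.\<close>

lemma discrete_crossing:
  fixes g :: "nat \<Rightarrow> 'a::linorder"
  assumes "g 0 \<le> y" "y \<le> g m" "0 < m"
  shows "\<exists>j<m. g j \<le> y \<and> y \<le> g (Suc j)"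
  using assms
proof (induction m)
  case (Suc m)
  then show ?case
    by (cases "y \<le> g m"; cases "m = 0") (auto simp: less_Suc_eq)
qed simp

section \<open>Sums of independent identically distributed variables\<close>

context prob_space
begin

lemma expectation_square_sum_indep:
  fixes Y :: "'i \<Rightarrow> 'a \<Rightarrow> real"
  assumes fin: "finite I" and ind: "indep_vars (\<lambda>_. borel) Y I"
    and sq: "\<And>i. i \<in> I \<Longrightarrow> integrable M (\<lambda>w. (Y i w)\<^sup>2)"
    and mean: "\<And>i. i \<in> I \<Longrightarrow> expectation (Y i) = 0"
  shows "expectation (\<lambda>w. (\<Sum>i\<in>I. Y i w)\<^sup>2) = (\<Sum>i\<in>I. expectation (\<lambda>w. (Y i w)\<^sup>2))"
    and "integrable M (\<lambda>w. (\<Sum>i\<in>I. Y i w)\<^sup>2)"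
proof -
  have meas: "Y i \<in> borel_measurable M" if "i \<in> I" for i
    using ind that by (auto simp: indep_vars_def)
  have int: "integrable M (Y i)" if "i \<in> I" for i
    using square_integrable_imp_integrable[OF meas sq] that by simp
  have ind2: "indep_vars (\<lambda>_. borel) Y {i, j}" if "i \<in> I" "j \<in> I" for i j
    using that by (intro indep_vars_subset[OF ind]) auto
  have int2: "integrable M (\<lambda>w. Y i w * Y j w)" if "i \<in> I" "j \<in> I" for i j
    using that sq int indep_vars_integrable[OF _ ind2[OF that]]
    by (cases "i = j") (auto simp: power2_eq_square)
  have cross: "expectation (\<lambda>w. Y i w * Y j w) = (if i = j then expectation (\<lambda>w. (Y i w)\<^sup>2) else 0)"
    if "i \<in> I" "j \<in> I" for i j
    using that int mean indep_vars_lebesgue_integral[OF _ ind2[OF that]]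
    by (cases "i = j") (auto simp: power2_eq_square)
  have eq: "(\<lambda>w. (\<Sum>i\<in>I. Y i w)\<^sup>2) = (\<lambda>w. \<Sum>i\<in>I. \<Sum>j\<in>I. Y i w * Y j w)"
    by (simp add: power2_eq_square sum_product)
  show "integrable M (\<lambda>w. (\<Sum>i\<in>I. Y i w)\<^sup>2)"
    unfolding eq by (intro Bochner_Integration.integrable_sum int2)
  show "expectation (\<lambda>w. (\<Sum>i\<in>I. Y i w)\<^sup>2) = (\<Sum>i\<in>I. expectation (\<lambda>w. (Y i w)\<^sup>2))"
    unfolding eq using fin
    by (simp add: Bochner_Integration.integral_sum int2 cross sum.delta)
qed

text \<open>Slutsky's lemma for characteristic functions: where \<open>Y n\<close> and
  \<open>Z n\<close> are close, the Lipschitz bound for \<open>iexp\<close> applies; elsewhere two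
  unimodular numbers differ by at most 2.\<close>

lemma char_tendsto_perturbation:
  fixes Y Z :: "nat \<Rightarrow> 'a \<Rightarrow> real"
  assumes [measurable]: "\<And>n. Y n \<in> borel_measurable M" "\<And>n. Z n \<in> borel_measurable M"
    and close: "\<And>e. 0 < e \<Longrightarrow> (\<lambda>n. prob {w \<in> space M. e < \<bar>Y n w - Z n w\<bar>}) \<longlonglongrightarrow> 0"
    and lim: "(\<lambda>n. char (distr M borel (Y n)) t) \<longlonglongrightarrow> c"
  shows "(\<lambda>n. char (distr M borel (Z n)) t) \<longlonglongrightarrow> c"
proof (rule Lim_transform[OF lim], rule tendstoI)
  fix e :: real assume e: "0 < e"
  \<comment> \<open>Half of \<open>e\<close> pays for the Lipschitz part, and twice a probability
    below \<open>e / 4\<close> for the rest. The summand 1 covers \<open>t = 0\<close>.\<close>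
  define d where "d = e / (2 * (\<bar>t\<bar> + 1))"
  have d: "0 < d" using e by (simp add: d_def)
  have dt: "\<bar>t\<bar> * d \<le> e / 2"
    using e by (simp add: d_def field_simps)
  have bound: "cmod (char (distr M borel (Z n)) t - char (distr M borel (Y n)) t)
      \<le> \<bar>t\<bar> * d + 2 * prob {w \<in> space M. d < \<bar>Y n w - Z n w\<bar>}" for n
  proof -
    have I: "integrable M (\<lambda>w. iexp (t * Z n w))" "integrable M (\<lambda>w. iexp (t * Y n w))"
      by (auto intro!: integrable_iexp simp flip: of_real_mult)
    have "cmod (char (distr M borel (Z n)) t - char (distr M borel (Y n)) t)
        = cmod (\<integral>w. iexp (t * Z n w) - iexp (t * Y n w) \<partial>M)"
      using I by (simp add: char_def integral_distr)
    also have "\<dots> \<le> (\<integral>w. cmod (iexp (t * Z n w) - iexp (t * Y n w)) \<partial>M)"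
      by (rule integral_norm_bound)
    also have "\<dots> \<le> (\<integral>w. \<bar>t\<bar> * d + 2 * indicator {w \<in> space M. d < \<bar>Y n w - Z n w\<bar>} w \<partial>M)"
    proof (rule integral_mono)
      show "integrable M (\<lambda>w. cmod (iexp (t * Z n w) - iexp (t * Y n w)))"
        using I by (intro integrable_norm Bochner_Integration.integrable_diff)
      show "integrable M (\<lambda>w. \<bar>t\<bar> * d + 2 * indicator {w \<in> space M. d < \<bar>Y n w - Z n w\<bar>} w)"
        by (intro Bochner_Integration.integrable_add integrable_mult_right
            integrable_real_indicator) (auto simp: less_top[symmetric])
      fix w assume w: "w \<in> space M"
      have n1: "cmod (iexp a) = 1" for a :: real by simp
      show "cmod (iexp (t * Z n w) - iexp (t * Y n w))
          \<le> \<bar>t\<bar> * d + 2 * indicator {w \<in> space M. d < \<bar>Y n w - Z n w\<bar>} w"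
      proof (cases "d < \<bar>Y n w - Z n w\<bar>")
        case True
        have "cmod (iexp (t * Z n w) - iexp (t * Y n w)) \<le> 2"
          using norm_triangle_ineq4[of "iexp (t * Z n w)" "iexp (t * Y n w)"] by simp
        also have "\<dots> \<le> \<bar>t\<bar> * d + 2" using d by simp
        finally show ?thesis using True w by simp
      next
        case False
        have "iexp (t * Z n w) - iexp (t * Y n w)
            = iexp (t * Y n w) * (iexp (t * (Z n w - Y n w)) - 1)"
          by (simp add: algebra_simps flip: exp_add)
        then have "cmod (iexp (t * Z n w) - iexp (t * Y n w))
            = cmod (iexp (t * (Z n w - Y n w)) - 1)"
          by (simp only: norm_mult n1 mult_1)
        also have "\<dots> \<le> \<bar>t * (Z n w - Y n w)\<bar>"
          using iexp_approx1[of "t * (Z n w - Y n w)" 0] by simp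
        also have "\<dots> \<le> \<bar>t\<bar> * d"
          unfolding abs_mult using False by (intro mult_left_mono) auto
        finally show ?thesis using False by simp
      qed
    qed
    also have "\<dots> = \<bar>t\<bar> * d + 2 * prob {w \<in> space M. d < \<bar>Y n w - Z n w\<bar>}"
      by (subst Bochner_Integration.integral_add)
        (auto simp: prob_space less_top[symmetric] intro!: integrable_real_indicator)
    finally show ?thesis .
  qed
  have "\<forall>\<^sub>F n in sequentially. prob {w \<in> space M. d < \<bar>Y n w - Z n w\<bar>} < e / 4"
    using order_tendstoD(2)[OF close[OF d], of "e / 4"] e by simp
  then show "\<forall>\<^sub>F n in sequentially.
      dist (char (distr M borel (Z n)) t - char (distr M borel (Y n)) t) 0 < e"
  proof eventually_elim
    case (elim n)
    then show ?case using bound[of n] dt by simp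
  qed
qed

end

text \<open>Equality in law is asked only of real-valued images. In the application the laws agree
  on the Borel sets of the whole space while independence refers to the orthant; this form fits
  both.\<close>

locale iid_sample = prob_space M for M :: "'w measure" +
  fixes N :: "'a measure" and Xs :: "nat \<Rightarrow> 'w \<Rightarrow> 'a"
  assumes indep: "indep_vars (\<lambda>_. N) Xs {1..}"
    and distr_eq: "\<And>l u. 1 \<le> l \<Longrightarrow> u \<in> borel_measurable N \<Longrightarrow>
      distr M borel (\<lambda>w. u (Xs l w) :: real) = distr M borel (\<lambda>w. u (Xs 1 w))"
begin

lemma measurable_Xs: "1 \<le> l \<Longrightarrow> Xs l \<in> measurable M N"
  using indep by (auto simp: indep_vars_def)

lemma measurable_comp_Xs: "1 \<le> l \<Longrightarrow> u \<in> borel_measurable N \<Longrightarrow> (\<lambda>w. u (Xs l w)) \<in> borel_measurable M"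
  using measurable_compose[OF measurable_Xs] .

lemma expectation_Xs:
  assumes "1 \<le> l" "u \<in> borel_measurable N"
  shows "expectation (\<lambda>w. u (Xs l w)) = expectation (\<lambda>w. u (Xs 1 w) :: real)"
proof -
  have "expectation (\<lambda>w. u (Xs l w)) = integral\<^sup>L (distr M borel (\<lambda>w. u (Xs l w))) (\<lambda>x. x)"
    using assms by (simp add: integral_distr measurable_comp_Xs)
  also have "\<dots> = expectation (\<lambda>w. u (Xs 1 w))"
    unfolding distr_eq[OF assms] using assms by (simp add: integral_distr measurable_comp_Xs)
  finally show ?thesis .
qed

lemma integrable_Xs:
  assumes "1 \<le> l" "u \<in> borel_measurable N" "\<And>y. y \<in> space N \<Longrightarrow> \<bar>u y\<bar> \<le> B"
  shows "integrable M (\<lambda>w. u (Xs l w) :: real)"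
  using assms measurable_space[OF measurable_Xs]
  by (intro integrable_const_bound[where B=B] measurable_comp_Xs AE_I2) auto

text \<open>Chebyshev's inequality, with the variance of each summand enlarged to its second moment.
  For indicators and for bounded multiples of them the second moment is directly comparable with a
  tail probability.\<close>

lemma sum_deviation:
  assumes u[measurable]: "u \<in> borel_measurable N" and B: "\<And>y. y \<in> space N \<Longrightarrow> \<bar>u y\<bar> \<le> B"
    and a: "0 < a"
  shows "prob {w \<in> space M. a \<le> \<bar>(\<Sum>l=1..n. u (Xs l w)) - n * expectation (\<lambda>w. u (Xs 1 w))\<bar>}
    \<le> n * expectation (\<lambda>w. (u (Xs 1 w))\<^sup>2) / a\<^sup>2"
proof -
  define m where "m = expectation (\<lambda>w. u (Xs 1 w))"
  define Y where "Y l w = u (Xs l w) - m" for l w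
  have 1: "1 \<le> (1::nat)" by simp
  have B': "\<bar>(u y)\<^sup>2\<bar> \<le> B\<^sup>2" if "y \<in> space N" for y
    using power_mono[OF B[OF that] abs_ge_zero, of 2] by simp
  have i1: "integrable M (\<lambda>w. u (Xs l w))" if "1 \<le> l" for l
    using integrable_Xs[OF that u B] .
  have i2: "integrable M (\<lambda>w. (u (Xs l w))\<^sup>2)" if "1 \<le> l" for l
    using integrable_Xs[OF that, of "\<lambda>y. (u y)\<^sup>2" "B\<^sup>2"] B' by simp
  have indY: "indep_vars (\<lambda>_. borel) Y {1..n}"
    unfolding Y_def
    by (rule indep_vars_subset[OF indep_vars_compose2[OF indep]]) auto
  have YY: "(Y l w)\<^sup>2 = (u (Xs l w))\<^sup>2 - 2 * m * u (Xs l w) + m\<^sup>2" for l w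
    by (simp add: Y_def power2_eq_square algebra_simps)
  have sqY: "integrable M (\<lambda>w. (Y l w)\<^sup>2)" if "l \<in> {1..n}" for l
    unfolding YY using i1[of l] i2[of l] that by simp
  have meanY: "expectation (Y l) = 0" if "l \<in> {1..n}" for l
    using expectation_Xs[of l u] that i1[of l] u unfolding Y_def m_def by (simp add: prob_space)
  have "expectation (\<lambda>w. (Y l w)\<^sup>2) \<le> expectation (\<lambda>w. (u (Xs 1 w))\<^sup>2)" if "l \<in> {1..n}" for l
  proof -
    have "expectation (\<lambda>w. (Y l w)\<^sup>2) = expectation (\<lambda>w. (u (Xs l w))\<^sup>2) - 2 * m * expectation (\<lambda>w. u (Xs l w)) + m\<^sup>2"
      unfolding YY using i1[of l] i2[of l] that by (simp add: prob_space)
    also have "expectation (\<lambda>w. (u (Xs l w))\<^sup>2) = expectation (\<lambda>w. (u (Xs 1 w))\<^sup>2)"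
      using that by (intro expectation_Xs) auto
    also have "expectation (\<lambda>w. u (Xs l w)) = m"
      unfolding m_def using that by (intro expectation_Xs) auto
    finally show ?thesis by (simp add: power2_eq_square)
  qed
  then have "(\<Sum>l=1..n. expectation (\<lambda>w. (Y l w)\<^sup>2)) \<le> n * expectation (\<lambda>w. (u (Xs 1 w))\<^sup>2)"
    using sum_mono[of "{1..n}" "\<lambda>l. expectation (\<lambda>w. (Y l w)\<^sup>2)" "\<lambda>_. expectation (\<lambda>w. (u (Xs 1 w))\<^sup>2)"]
    by simp
  then have le: "expectation (\<lambda>w. (\<Sum>l=1..n. Y l w)\<^sup>2) \<le> n * expectation (\<lambda>w. (u (Xs 1 w))\<^sup>2)"
    using expectation_square_sum_indep(1)[OF _ indY sqY meanY] by simp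
  have int: "integrable M (\<lambda>w. (\<Sum>l=1..n. Y l w)\<^sup>2)"
    using expectation_square_sum_indep(2)[OF _ indY sqY meanY] by simp
  have "{w \<in> space M. a \<le> \<bar>(\<Sum>l=1..n. u (Xs l w)) - n * m\<bar>}
      = {w \<in> space M. a\<^sup>2 \<le> (\<Sum>l=1..n. Y l w)\<^sup>2}"
    using a by (auto simp: Y_def sum_subtractf abs_le_square_iff[symmetric])
  also have "prob \<dots> \<le> expectation (\<lambda>w. (\<Sum>l=1..n. Y l w)\<^sup>2) / a\<^sup>2"
    using int a by (intro integral_Markov_inequality_measure[of M _ "{}", simplified]) auto
  also have "\<dots> \<le> n * expectation (\<lambda>w. (u (Xs 1 w))\<^sup>2) / a\<^sup>2"
    using le a by (simp add: divide_right_mono)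
  finally show ?thesis unfolding m_def .
qed

text \<open>The weak law for rows: half of \<open>e\<close> absorbs the error of the mean, the other
  half is left to Chebyshev's inequality. The bounds \<open>B n\<close> may depend on
  \<open>n\<close> freely, since they serve only integrability.\<close>

lemma row_sums_tendsto_in_prob:
  fixes u :: "nat \<Rightarrow> 'a \<Rightarrow> real"
  assumes u: "\<And>n. u n \<in> borel_measurable N" and B: "\<And>n y. y \<in> space N \<Longrightarrow> \<bar>u n y\<bar> \<le> B n"
    and mean: "(\<lambda>n. n * expectation (\<lambda>w. u n (Xs 1 w))) \<longlonglongrightarrow> m"
    and sq: "(\<lambda>n. n * expectation (\<lambda>w. (u n (Xs 1 w))\<^sup>2)) \<longlonglongrightarrow> 0"
    and e: "0 < e"
  shows "(\<lambda>n. prob {w \<in> space M. e < \<bar>(\<Sum>l=1..n. u n (Xs l w)) - m\<bar>}) \<longlonglongrightarrow> 0"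
proof (rule tendsto_sandwich[OF _ _ tendsto_const])
  show "\<forall>\<^sub>F n in sequentially. 0 \<le> prob {w \<in> space M. e < \<bar>(\<Sum>l=1..n. u n (Xs l w)) - m\<bar>}"
    by simp
  have "\<forall>\<^sub>F n in sequentially. \<bar>n * expectation (\<lambda>w. u n (Xs 1 w)) - m\<bar> < e / 2"
    using tendstoD[OF mean, of "e / 2"] e by (simp add: dist_real_def)
  then show "\<forall>\<^sub>F n in sequentially. prob {w \<in> space M. e < \<bar>(\<Sum>l=1..n. u n (Xs l w)) - m\<bar>}
      \<le> n * expectation (\<lambda>w. (u n (Xs 1 w))\<^sup>2) / (e / 2)\<^sup>2"
  proof eventually_elim
    case (elim n)
    have [measurable]: "(\<lambda>w. \<Sum>l=1..n. u n (Xs l w)) \<in> borel_measurable M"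
      using u by (intro borel_measurable_sum measurable_comp_Xs) auto
    have "prob {w \<in> space M. e < \<bar>(\<Sum>l=1..n. u n (Xs l w)) - m\<bar>}
        \<le> prob {w \<in> space M. e / 2 \<le> \<bar>(\<Sum>l=1..n. u n (Xs l w)) - n * expectation (\<lambda>w. u n (Xs 1 w))\<bar>}"
    proof (rule finite_measure_mono)
      show "{w \<in> space M. e < \<bar>(\<Sum>l=1..n. u n (Xs l w)) - m\<bar>}
          \<subseteq> {w \<in> space M. e / 2 \<le> \<bar>(\<Sum>l=1..n. u n (Xs l w)) - n * expectation (\<lambda>w. u n (Xs 1 w))\<bar>}"
        using elim by (safe, linarith)
      show "{w \<in> space M. e / 2 \<le> \<bar>(\<Sum>l=1..n. u n (Xs l w)) - n * expectation (\<lambda>w. u n (Xs 1 w))\<bar>} \<in> events"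
        by measurable
    qed
    also have "\<dots> \<le> n * expectation (\<lambda>w. (u n (Xs 1 w))\<^sup>2) / (e / 2)\<^sup>2"
      using e by (intro sum_deviation[OF u, where B="B n"] B) auto
    finally show ?case .
  qed
  show "(\<lambda>n. n * expectation (\<lambda>w. (u n (Xs 1 w))\<^sup>2) / (e / 2)\<^sup>2) \<longlonglongrightarrow> 0"
    using tendsto_divide[OF sq tendsto_const, of "(e / 2)\<^sup>2"] e by simp
qed

text \<open>A central limit theorem for rows. The summands need only be nearly centred, because the
  first-order term of the characteristic function contributes \<open>t\<close> times
  \<open>n\<close> times the mean, which vanishes. The uniform bound \<open>B n\<close>, tending to
  0, takes the place of Lindeberg's condition: the third absolute moment is at most
  \<open>B n\<close> times the second moment.\<close>

lemma char_row_sums_tendsto: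
  fixes u :: "nat \<Rightarrow> 'a \<Rightarrow> real"
  assumes u: "\<And>n. u n \<in> borel_measurable N" and B: "\<And>n y. y \<in> space N \<Longrightarrow> \<bar>u n y\<bar> \<le> B n"
    and B0: "B \<longlonglongrightarrow> 0"
    and mean: "(\<lambda>n. n * expectation (\<lambda>w. u n (Xs 1 w))) \<longlonglongrightarrow> 0"
    and sq: "(\<lambda>n. n * expectation (\<lambda>w. (u n (Xs 1 w))\<^sup>2)) \<longlonglongrightarrow> v"
  shows "(\<lambda>n. char (distr M borel (\<lambda>w. \<Sum>l=1..n. u n (Xs l w))) t) \<longlonglongrightarrow> of_real (exp (- v * t\<^sup>2 / 2))"
proof -
  define \<phi> where "\<phi> n = char (distr M borel (\<lambda>w. u n (Xs 1 w))) t" for n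
  define a where "a = - v * t\<^sup>2 / 2"
  define m1 where "m1 n = expectation (\<lambda>w. u n (Xs 1 w))" for n
  define m2 where "m2 n = expectation (\<lambda>w. (u n (Xs 1 w))\<^sup>2)" for n
  have one: "1 \<le> (1::nat)" by simp
  have U[measurable]: "(\<lambda>w. u n (Xs 1 w)) \<in> borel_measurable M" for n
    using u by (intro measurable_comp_Xs) auto
  have Bw: "\<bar>u n (Xs 1 w)\<bar> \<le> B n" if "w \<in> space M" for n w
    using B measurable_space[OF measurable_Xs[OF one] that] by simp
  have intpow: "integrable M (\<lambda>w. u n (Xs 1 w) ^ j)" for n j
    using Bw[of _ n] borel_measurable_power[OF U[of n], of j]
    by (intro integrable_const_bound[where B="B n ^ j"] AE_I2) (auto simp: power_abs intro!: power_mono)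
  have power: "char (distr M borel (\<lambda>w. \<Sum>l=1..n. u n (Xs l w))) t = \<phi> n ^ n" for n
  proof -
    have "indep_vars (\<lambda>_. borel) (\<lambda>l w. u n (Xs l w)) {1..n}"
      by (rule indep_vars_subset[OF indep_vars_compose2[OF indep]]) (auto simp: u)
    from char_distr_sum[OF this, of t]
    have "char (distr M borel (\<lambda>w. \<Sum>l=1..n. u n (Xs l w))) t
        = (\<Prod>l=1..n. char (distr M borel (\<lambda>w. u n (Xs l w))) t)" .
    also have "\<dots> = (\<Prod>l=1..n. \<phi> n)"
      unfolding \<phi>_def by (intro prod.cong refl, subst distr_eq) (auto simp: u)
    finally show ?thesis by simp
  qed
  have approx: "cmod (\<phi> n - (1 - t\<^sup>2 * m2 n / 2)) \<le> \<bar>t\<bar> * \<bar>m1 n\<bar> + \<bar>t\<bar>^3 * (B n * m2 n)" for n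
  proof -
    define m3 where "m3 = expectation (\<lambda>w. u n (Xs 1 w) ^ 3)"
    define a3 where "a3 = expectation (\<lambda>w. \<bar>u n (Xs 1 w)\<bar> ^ 3)"
    have "cmod (\<phi> n - (\<Sum>k\<le>3. ((\<i> * t)^k / fact k) * expectation (\<lambda>w. u n (Xs 1 w) ^ k)))
        \<le> (2 * \<bar>t\<bar>^3 / fact 3) * a3"
      unfolding \<phi>_def a3_def by (rule char_approx1'[OF intpow U refl])
    \<comment> \<open>The terms of order 0 and 2 are the approximation to be kept; those of order 1
      and 3 are counted as error.\<close>
    also have "(\<Sum>k\<le>3. ((\<i> * t)^k / fact k) * expectation (\<lambda>w. u n (Xs 1 w) ^ k))
        = (1 - t\<^sup>2 * m2 n / 2) + (\<i> * t * m1 n - \<i> * t^3 / 6 * m3)"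
      by (simp add: eval_nat_numeral m1_def m2_def m3_def prob_space algebra_simps)
    finally have 1: "cmod (\<phi> n - ((1 - t\<^sup>2 * m2 n / 2) + (\<i> * t * m1 n - \<i> * t^3 / 6 * m3)))
        \<le> \<bar>t\<bar>^3 / 3 * a3" by (simp add: fact_numeral)
    have "a3 \<le> expectation (\<lambda>w. B n * (u n (Xs 1 w))\<^sup>2)"
      unfolding a3_def
    proof (rule integral_mono)
      fix w assume w: "w \<in> space M"
      have "\<bar>u n (Xs 1 w)\<bar> ^ 3 = \<bar>u n (Xs 1 w)\<bar> * (u n (Xs 1 w))\<^sup>2"
        by (simp add: power3_eq_cube power2_eq_square)
      also have "\<dots> \<le> B n * (u n (Xs 1 w))\<^sup>2"
        using Bw[OF w] by (intro mult_right_mono) auto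
      finally show "\<bar>u n (Xs 1 w)\<bar> ^ 3 \<le> B n * (u n (Xs 1 w))\<^sup>2" .
    qed (use integrable_abs[OF intpow[of n 3]] intpow[of n 2] in \<open>auto simp: power_abs\<close>)
    then have a3: "a3 \<le> B n * m2 n" by (simp add: m2_def)
    have m3: "\<bar>m3\<bar> \<le> a3"
      unfolding m3_def a3_def using integral_abs_bound[of M "\<lambda>w. u n (Xs 1 w) ^ 3"] by (simp add: power_abs)
    have "cmod (\<phi> n - (1 - t\<^sup>2 * m2 n / 2))
        \<le> \<bar>t\<bar>^3 / 3 * a3 + cmod (\<i> * t * m1 n - \<i> * t^3 / 6 * m3)"
      using 1 norm_triangle_ineq[of "\<phi> n - ((1 - t\<^sup>2 * m2 n / 2) + (\<i> * t * m1 n - \<i> * t^3 / 6 * m3))"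
        "\<i> * t * m1 n - \<i> * t^3 / 6 * m3"] by (simp add: algebra_simps)
    also have "cmod (\<i> * t * m1 n - \<i> * t^3 / 6 * m3) \<le> \<bar>t\<bar> * \<bar>m1 n\<bar> + \<bar>t\<bar>^3 / 6 * \<bar>m3\<bar>"
      using norm_triangle_ineq4[of "\<i> * t * m1 n" "\<i> * t^3 / 6 * m3"]
      by (simp add: norm_mult norm_divide norm_power)
    also have "\<bar>t\<bar>^3 / 6 * \<bar>m3\<bar> \<le> \<bar>t\<bar>^3 / 6 * (B n * m2 n)"
      using a3 m3 by (intro mult_left_mono) auto
    also have "\<bar>t\<bar>^3 / 3 * a3 \<le> \<bar>t\<bar>^3 / 3 * (B n * m2 n)"
      using a3 by (intro mult_left_mono) auto
    finally have "cmod (\<phi> n - (1 - t\<^sup>2 * m2 n / 2))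
        \<le> \<bar>t\<bar> * \<bar>m1 n\<bar> + (1/2) * (\<bar>t\<bar>^3 * (B n * m2 n))" by (simp add: field_simps)
    moreover have "0 \<le> \<bar>t\<bar>^3 * (B n * m2 n)"
      using a3 m3 by (intro mult_nonneg_nonneg[OF zero_le_power]) auto
    ultimately show ?thesis by linarith
  qed
  have lim0: "(\<lambda>n. \<bar>t\<bar> * \<bar>n * m1 n\<bar> + \<bar>t\<bar>^3 * (B n * (n * m2 n)) + \<bar>t\<^sup>2 / 2 * (n * m2 n - v)\<bar>) \<longlonglongrightarrow> \<bar>t\<bar> * \<bar>0\<bar> + \<bar>t\<bar>^3 * (0 * v) + \<bar>t\<^sup>2 / 2 * (v - v)\<bar>"
    using mean sq B0 unfolding m1_def m2_def by (intro tendsto_intros)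
  \<comment> \<open>As \<open>a\<close> is nonpositive, \<open>1 + a / n\<close> lies in [-1, 1]
    from \<open>n0\<close> on. Both bases then have modulus at most 1, and their \<open>n\<close>-th
    powers differ by at most \<open>n\<close> times the difference of the bases.\<close>
  obtain n0 :: nat where n0: "\<bar>a\<bar> / 2 \<le> n0" using real_arch_simple by blast
  have v: "0 \<le> v"
    by (rule LIMSEQ_le_const[OF sq]) auto
  have "\<forall>\<^sub>F n in sequentially. cmod (\<phi> n ^ n - of_real ((1 + a / n) ^ n))
      \<le> \<bar>t\<bar> * \<bar>n * m1 n\<bar> + \<bar>t\<bar>^3 * (B n * (n * m2 n)) + \<bar>t\<^sup>2 / 2 * (n * m2 n - v)\<bar>"
    using eventually_ge_at_top[of n0] eventually_gt_at_top[of 0]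
  proof eventually_elim
    case (elim n)
    have "cmod (of_real (1 + a / n)) \<le> 1"
    proof -
      have "a \<le> 0" using v by (simp add: a_def)
      moreover have "- 2 * n \<le> a" using n0 elim by linarith
      ultimately show ?thesis using elim by (simp only: norm_of_real) (auto simp: abs_le_iff field_simps)
    qed
    moreover have "cmod (\<phi> n) \<le> 1"
      unfolding \<phi>_def by (intro real_distribution.cmod_char_le_1 real_distribution_distr U)
    ultimately have "cmod (\<phi> n ^ n - (of_real (1 + a / n)) ^ n) \<le> n * cmod (\<phi> n - of_real (1 + a / n))"
      by (intro norm_power_diff) auto
    also have "cmod (\<phi> n - of_real (1 + a / n)) \<le> cmod (\<phi> n - (1 - t\<^sup>2 * m2 n / 2))
        + cmod (complex_of_real (1 - t\<^sup>2 * m2 n / 2) - complex_of_real (1 + a / n))"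
      by (rule norm_diff_triangle_le[OF order_refl order_refl])
    also have "complex_of_real (1 - t\<^sup>2 * m2 n / 2) - complex_of_real (1 + a / n)
        = complex_of_real (- (t\<^sup>2 / 2 * (n * m2 n - v)) / n)"
      unfolding of_real_diff[symmetric] using elim
      by (intro arg_cong[where f=complex_of_real]) (simp add: a_def field_simps)
    also have "cmod \<dots> = \<bar>t\<^sup>2 / 2 * (n * m2 n - v)\<bar> / n"
      by (subst norm_of_real, subst abs_divide) (simp only: abs_minus_cancel abs_of_nat)
    finally have "cmod (\<phi> n ^ n - (of_real (1 + a / n)) ^ n)
        \<le> n * ((\<bar>t\<bar> * \<bar>m1 n\<bar> + \<bar>t\<bar>^3 * (B n * m2 n)) + \<bar>t\<^sup>2 / 2 * (n * m2 n - v)\<bar> / n)"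
      using approx[of n] by (smt (verit) mult_left_mono of_nat_0_le_iff)
    also have "\<dots> = \<bar>t\<bar> * \<bar>n * m1 n\<bar> + \<bar>t\<bar>^3 * (B n * (n * m2 n)) + \<bar>t\<^sup>2 / 2 * (n * m2 n - v)\<bar>"
      using elim by (simp add: field_simps abs_mult)
    finally show ?case by simp
  qed
  then have "(\<lambda>n. \<phi> n ^ n - of_real ((1 + a / n) ^ n)) \<longlonglongrightarrow> 0"
    by (rule Lim_null_comparison) (use lim0 in simp)
  then have diff: "(\<lambda>n. \<phi> n ^ n - complex_of_real ((1 + a / n) ^ n)) \<longlonglongrightarrow> 0" by simp
  have "(\<lambda>n. complex_of_real ((1 + a / n) ^ n)) \<longlonglongrightarrow> complex_of_real (exp a)"
    by (rule isCont_tendsto_compose[OF _ tendsto_exp_limit_sequentially]) auto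
  then have "(\<lambda>n. \<phi> n ^ n) \<longlonglongrightarrow> complex_of_real (exp a)"
    by (rule Lim_transform[OF _ diff])
  then show ?thesis unfolding power a_def .
qed

end

section \<open>Sums over the largest observations\<close>

context iid_sample
begin

lemma measurable_kth_largest:
  assumes \<rho>: "\<rho> \<in> borel_measurable N" and k: "1 \<le> k" "k \<le> n"
  shows "(\<lambda>w. kth_largest k (map (\<lambda>l. \<rho> (Xs l w)) [1..<n + 1])) \<in> borel_measurable M"
proof (subst borel_measurable_iff_ge, rule allI)
  fix a :: real
  have [measurable]: "(\<lambda>w. \<rho> (Xs l w)) \<in> borel_measurable M" if "l \<in> {1..n}" for l
    using that \<rho> by (intro measurable_comp_Xs) auto
  have [measurable]: "(\<lambda>w. exceedances (\<lambda>l. \<rho> (Xs l w)) n a) \<in> borel_measurable M"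
    unfolding exceedances_def by measurable
  show "{w \<in> space M. a \<le> kth_largest k (map (\<lambda>l. \<rho> (Xs l w)) [1..<n + 1])} \<in> events"
    unfolding le_kth_largest_iff_exceedances[OF k] by measurable
qed

lemma measurable_sum_above_kth_largest:
  assumes \<rho>: "\<rho> \<in> borel_measurable N" and \<phi>: "\<phi> \<in> borel_measurable N" and k: "1 \<le> k" "k \<le> n"
  shows "(\<lambda>w. \<Sum>l=1..n. \<phi> (Xs l w) *
    of_bool (kth_largest k (map (\<lambda>l. \<rho> (Xs l w)) [1..<n + 1]) \<le> \<rho> (Xs l w)) :: real) \<in> borel_measurable M"
proof -
  have [measurable]: "(\<lambda>w. \<rho> (Xs l w)) \<in> borel_measurable M" 
    "(\<lambda>w. \<phi> (Xs l w)) \<in> borel_measurable M" if "l \<in> {1..n}" for l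
    using that \<rho> \<phi> by (auto intro!: measurable_comp_Xs)
  note [measurable] = measurable_kth_largest[OF \<rho> k]
  show ?thesis by measurable
qed

text \<open>The probabilistic core, kept free of regular variation: the levels \<open>x s n\<close>
  matter only through the expected count and the bias for each \<open>s\<close>, and through the
  second moment at \<open>s = 0\<close>. The formula for \<open>Z\<close> is imposed only for large
  \<open>n\<close>, when \<open>k n\<close> is a valid rank.\<close>

theorem char_sum_above_kth_largest_tendsto:
  fixes \<rho> \<phi> :: "'a \<Rightarrow> real" and x :: "real \<Rightarrow> nat \<Rightarrow> real" and q :: "real \<Rightarrow> nat \<Rightarrow> real"
    and Z :: "nat \<Rightarrow> 'w \<Rightarrow> real" and k :: "nat \<Rightarrow> nat" and c :: real
  defines "q \<equiv> \<lambda>s n. expectation (\<lambda>w. of_bool (x s n \<le> \<rho> (Xs 1 w)))"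
  assumes \<rho>[measurable]: "\<rho> \<in> borel_measurable N" and \<phi>[measurable]: "\<phi> \<in> borel_measurable N"
    and B: "\<And>y. y \<in> space N \<Longrightarrow> \<bar>\<phi> y\<bar> \<le> B"
    and nonneg: "\<And>y. y \<in> space N \<Longrightarrow> 0 < \<rho> y \<Longrightarrow> 0 \<le> \<phi> y"
    and k_inf: "filterlim k at_top sequentially"
    and k_le: "\<forall>\<^sub>F n in sequentially. k n \<le> n"
    and x_pos: "\<And>s. \<forall>\<^sub>F n in sequentially. 0 < x s n"
    and count: "\<And>s. (\<lambda>n. (n * q s n - k n) / sqrt (k n)) \<longlonglongrightarrow> s"
    and bias: "\<And>s. (\<lambda>n. n * expectation (\<lambda>w. (\<phi> (Xs 1 w) - c) * of_bool (x s n \<le> \<rho> (Xs 1 w))) / sqrt (k n)) \<longlonglongrightarrow> 0"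
    and var: "(\<lambda>n. n * expectation (\<lambda>w. (\<phi> (Xs 1 w) - c)\<^sup>2 * of_bool (x 0 n \<le> \<rho> (Xs 1 w))) / k n) \<longlonglongrightarrow> v"
    and Z_meas[measurable]: "\<And>n. Z n \<in> borel_measurable M"
    and Z: "\<forall>\<^sub>F n in sequentially. \<forall>w\<in>space M. Z n w =
      ((\<Sum>l=1..n. \<phi> (Xs l w) * of_bool (kth_largest (k n) (map (\<lambda>l. \<rho> (Xs l w)) [1..<n + 1]) \<le> \<rho> (Xs l w)))
        - c * k n) / sqrt (k n)"
  shows "(\<lambda>n. char (distr M borel (Z n)) t) \<longlonglongrightarrow> of_real (exp (- v * t\<^sup>2 / 2))"
proof -

  \<comment> \<open>Normalized centred sums and exceedance counts at deterministic levels\<close>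
  define J where "J s n y = (of_bool (x s n \<le> \<rho> y) :: real)" for s n y
  define W where "W s n y = (\<phi> y - c) * J s n y / sqrt (k n)" for s n y
  define S where "S s n w = (\<Sum>l=1..n. W s n (Xs l w))" for s n w
  define Cnt where "Cnt s n w = (\<Sum>l=1..n. J s n (Xs l w))" for s n w
  have J01: "0 \<le> J s n y" "J s n y \<le> 1" for s n y by (auto simp: J_def)
  have J[measurable]: "J s n \<in> borel_measurable N" for s n
    unfolding J_def[abs_def] by measurable
  have W[measurable]: "W s n \<in> borel_measurable N" for s n
    unfolding W_def[abs_def] by measurable
  have X1[measurable]: "Xs 1 \<in> measurable M N" by (rule measurable_Xs) simp
  have Jabs: "\<bar>J s n y\<bar> \<le> 1" for s n y using J01 by (simp add: abs_le_iff)
  have iJ: "integrable M (\<lambda>w. J s n (Xs 1 w))" for s n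
    by (rule integrable_Xs[OF _ J Jabs]) simp
  have q: "q s n = expectation (\<lambda>w. J s n (Xs 1 w))" for s n
    by (simp add: q_def J_def)
  have C0: "0 \<le> B + \<bar>c\<bar>" if "y \<in> space N" for y using B[OF that] by linarith
  have C: "\<bar>\<phi> y - c\<bar> \<le> B + \<bar>c\<bar>" if "y \<in> space N" for y using B[OF that] by linarith
  have WB: "\<bar>W s n y\<bar> \<le> (B + \<bar>c\<bar>) / sqrt (k n)" if "y \<in> space N" for s n y
  proof -
    have "\<bar>W s n y\<bar> = \<bar>\<phi> y - c\<bar> * J s n y / sqrt (k n)"
      using J01(1)[of s n y] by (simp add: W_def abs_mult)
    also have "\<dots> \<le> (B + \<bar>c\<bar>) * 1 / sqrt (k n)"
      using C[OF that] C0[OF that] J01 by (intro divide_right_mono mult_mono) auto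
    finally show ?thesis by simp
  qed
  have rk: "filterlim (\<lambda>n. real (k n)) at_top sequentially"
    by (rule filterlim_compose[OF filterlim_real_sequentially k_inf])
  have sk: "filterlim (\<lambda>n. sqrt (real (k n))) at_top sequentially"
    by (rule filterlim_compose[OF sqrt_at_top rk])
  have isk: "(\<lambda>n. a / sqrt (real (k n))) \<longlonglongrightarrow> 0" for a
    by (rule tendsto_divide_0[OF tendsto_const filterlim_at_top_imp_at_infinity[OF sk]])
  have k_pos: "\<forall>\<^sub>F n in sequentially. 1 \<le> k n"
    using k_inf by (simp add: filterlim_at_top)
  have qk: "(\<lambda>n. n * q s n / k n) \<longlonglongrightarrow> 1" for s
  proof -
    have "(\<lambda>n. (n * q s n - k n) / sqrt (k n) * (1 / sqrt (k n)) + 1) \<longlonglongrightarrow> s * 0 + 1"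
      by (intro tendsto_intros count isk)
    then have "(\<lambda>n. (n * q s n - k n) / sqrt (k n) * (1 / sqrt (k n)) + 1) \<longlonglongrightarrow> 1" by simp
    then show ?thesis
    proof (rule Lim_transform_eventually)
      show "\<forall>\<^sub>F n in sequentially. (n * q s n - k n) / sqrt (k n) * (1 / sqrt (k n)) + 1 = n * q s n / k n"
        using k_pos by eventually_elim (simp add: field_simps)
    qed
  qed
  have iW: "integrable M (\<lambda>w. W s n (Xs 1 w))" for s n
    by (rule integrable_Xs[OF _ W WB]) simp

  \<comment> \<open>Asymptotic normality at the level with parameter 0\<close>
  have charS: "(\<lambda>n. char (distr M borel (S 0 n)) t) \<longlonglongrightarrow> of_real (exp (- v * t\<^sup>2 / 2))"
    unfolding S_def[abs_def]
  proof (rule char_row_sums_tendsto[OF W WB isk])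
    show "(\<lambda>n. n * expectation (\<lambda>w. W 0 n (Xs 1 w))) \<longlonglongrightarrow> 0"
      using bias[of 0] by (simp add: W_def J_def)
    have "(W 0 n y)\<^sup>2 = (\<phi> y - c)\<^sup>2 * J 0 n y / k n" for n y
      by (simp add: W_def J_def power_divide power_mult_distrib)
    then show "(\<lambda>n. n * expectation (\<lambda>w. (W 0 n (Xs 1 w))\<^sup>2)) \<longlonglongrightarrow> v"
      using var by (simp add: J_def)
  qed

  \<comment> \<open>Comparison of sums and counts at two levels\<close>
  have sq0: "(\<lambda>n. n * expectation (\<lambda>w. (g (Xs 1 w) * (J s n (Xs 1 w) - J s' n (Xs 1 w)) / sqrt (k n))\<^sup>2)) \<longlonglongrightarrow> 0"
    if g[measurable]: "g \<in> borel_measurable N" and gB: "\<And>y. y \<in> space N \<Longrightarrow> \<bar>g y\<bar> \<le> D" for g D s s'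
  proof (rule tendsto_sandwich[OF _ _ tendsto_const])
    show "\<forall>\<^sub>F n in sequentially. 0 \<le> n * expectation (\<lambda>w. (g (Xs 1 w) * (J s n (Xs 1 w) - J s' n (Xs 1 w)) / sqrt (k n))\<^sup>2)"
      by simp
    have "(\<lambda>n. D\<^sup>2 * \<bar>n * q s n / k n - n * q s' n / k n\<bar>) \<longlonglongrightarrow> D\<^sup>2 * \<bar>1 - 1\<bar>"
      by (intro tendsto_intros qk)
    then show "(\<lambda>n. D\<^sup>2 * \<bar>n * q s n / k n - n * q s' n / k n\<bar>) \<longlonglongrightarrow> 0" by simp
    \<comment> \<open>Exceedance indicators at two levels are nested, so the square of their
      difference is its absolute value, with expectation \<open>\<bar>q s n - q s' n\<bar>\<close>.
      Both expected counts are asymptotically \<open>k\<close>, so after division by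
      \<open>k\<close> the difference disappears.\<close>
    have bound: "n * expectation (\<lambda>w. (g (Xs 1 w) * (J s n (Xs 1 w) - J s' n (Xs 1 w)) / sqrt (k n))\<^sup>2)
      \<le> D\<^sup>2 * \<bar>n * q s n / k n - n * q s' n / k n\<bar>" for n
    proof -
      have e1: "expectation (\<lambda>w. \<bar>J s n (Xs 1 w) - J s' n (Xs 1 w)\<bar>) = \<bar>q s n - q s' n\<bar>"
      proof (cases "x s n \<le> x s' n")
        case True
        then have "J s' n y \<le> J s n y" for y by (simp add: J_def of_bool_def)
        then have "\<bar>J s n y - J s' n y\<bar> = J s n y - J s' n y" for y by simp
        moreover from this have "0 \<le> expectation (\<lambda>w. J s n (Xs 1 w) - J s' n (Xs 1 w))"
          by (intro Bochner_Integration.integral_nonneg) (metis abs_ge_zero)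
        ultimately show ?thesis using iJ by (simp add: q)
      next
        case False
        then have "J s n y \<le> J s' n y" for y by (simp add: J_def of_bool_def)
        then have "\<bar>J s n y - J s' n y\<bar> = J s' n y - J s n y" for y by simp
        moreover from this have "0 \<le> expectation (\<lambda>w. J s' n (Xs 1 w) - J s n (Xs 1 w))"
          by (intro Bochner_Integration.integral_nonneg) (metis abs_ge_zero)
        ultimately show ?thesis using iJ by (simp add: q)
      qed
      have pw: "(g y * (J s n y - J s' n y) / sqrt (k n))\<^sup>2 \<le> D\<^sup>2 / k n * \<bar>J s n y - J s' n y\<bar>"
        if "y \<in> space N" for y
      proof -
        have "(J s n y - J s' n y)\<^sup>2 = \<bar>J s n y - J s' n y\<bar>" by (simp add: J_def of_bool_def)
        then have "(g y * (J s n y - J s' n y) / sqrt (k n))\<^sup>2 = \<bar>g y\<bar>\<^sup>2 / k n * \<bar>J s n y - J s' n y\<bar>"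
          by (simp add: power_mult_distrib power_divide)
        also have "\<dots> \<le> D\<^sup>2 / k n * \<bar>J s n y - J s' n y\<bar>"
          using gB[OF that] by (intro mult_right_mono divide_right_mono power_mono) auto
        finally show ?thesis .
      qed
      have iD: "integrable M (\<lambda>w. D\<^sup>2 / k n * \<bar>J s n (Xs 1 w) - J s' n (Xs 1 w)\<bar>)"
        using iJ by (intro integrable_mult_right integrable_abs Bochner_Integration.integrable_diff)
      have "expectation (\<lambda>w. (g (Xs 1 w) * (J s n (Xs 1 w) - J s' n (Xs 1 w)) / sqrt (k n))\<^sup>2)
          \<le> expectation (\<lambda>w. D\<^sup>2 / k n * \<bar>J s n (Xs 1 w) - J s' n (Xs 1 w)\<bar>)"
        using pw measurable_space[OF X1] by (intro integral_mono' iD) auto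
      also have "\<dots> = D\<^sup>2 / k n * \<bar>q s n - q s' n\<bar>" using e1 by simp
      finally have "n * expectation (\<lambda>w. (g (Xs 1 w) * (J s n (Xs 1 w) - J s' n (Xs 1 w)) / sqrt (k n))\<^sup>2)
          \<le> n * (D\<^sup>2 / k n * \<bar>q s n - q s' n\<bar>)" by (intro mult_left_mono) auto
      also have "\<dots> = D\<^sup>2 * \<bar>n * (q s n - q s' n) / k n\<bar>"
        by (simp add: abs_mult)
      also have "n * (q s n - q s' n) / k n = n * q s n / k n - n * q s' n / k n"
        by (simp add: right_diff_distrib diff_divide_distrib)
      finally show ?thesis .
    qed
    then show "\<forall>\<^sub>F n in sequentially. n * expectation (\<lambda>w. (g (Xs 1 w) * (J s n (Xs 1 w) - J s' n (Xs 1 w)) / sqrt (k n))\<^sup>2)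
      \<le> D\<^sup>2 * \<bar>n * q s n / k n - n * q s' n / k n\<bar>" by simp
  qed
  have closeS: "(\<lambda>n. prob {w \<in> space M. e < \<bar>S s n w - S 0 n w\<bar>}) \<longlonglongrightarrow> 0" if e: "0 < e" for e s
  proof -
    have "(\<lambda>n. prob {w \<in> space M. e < \<bar>(\<Sum>l=1..n. W s n (Xs l w) - W 0 n (Xs l w)) - 0\<bar>}) \<longlonglongrightarrow> 0"
    proof (rule row_sums_tendsto_in_prob[OF _ _ _ _ e, where u="\<lambda>n y. W s n y - W 0 n y"])
      show "\<bar>W s n y - W 0 n y\<bar> \<le> (B + \<bar>c\<bar>) / sqrt (k n) + (B + \<bar>c\<bar>) / sqrt (k n)" if "y \<in> space N" for n y
        using WB[OF that, of s n] WB[OF that, of 0 n] by linarith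
      have "(\<lambda>n. n * expectation (\<lambda>w. W s n (Xs 1 w)) - n * expectation (\<lambda>w. W 0 n (Xs 1 w))) \<longlonglongrightarrow> 0 - 0"
        using bias[of 0] bias[of s] by (intro tendsto_diff) (simp_all add: W_def J_def)
      then show "(\<lambda>n. n * expectation (\<lambda>w. W s n (Xs 1 w) - W 0 n (Xs 1 w))) \<longlonglongrightarrow> 0"
        using iW by (simp add: right_diff_distrib)
      have "W s n y - W 0 n y = (\<phi> y - c) * (J s n y - J 0 n y) / sqrt (k n)" for n y
        by (simp add: W_def right_diff_distrib diff_divide_distrib)
      then show "(\<lambda>n. n * expectation (\<lambda>w. (W s n (Xs 1 w) - W 0 n (Xs 1 w))\<^sup>2)) \<longlonglongrightarrow> 0"
        using sq0[of "\<lambda>y. \<phi> y - c", OF _ C, of s 0] by simp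
    qed simp
    then show ?thesis by (simp add: S_def sum_subtractf)
  qed
  \<comment> \<open>Each count may fluctuate by order sqrt k, but the number of observations between
    two levels concentrates at \<open>(s - s') * sqrt k\<close>: its variance is of smaller order
    than \<open>k\<close>.\<close>
  have closeN: "(\<lambda>n. prob {w \<in> space M. e < \<bar>(Cnt s n w - Cnt s' n w) / sqrt (k n) - (s - s')\<bar>}) \<longlonglongrightarrow> 0"
    if e: "0 < e" for e s s'
  proof -
    have "(\<lambda>n. prob {w \<in> space M. e < \<bar>(\<Sum>l=1..n. (J s n (Xs l w) - J s' n (Xs l w)) / sqrt (k n)) - (s - s')\<bar>}) \<longlonglongrightarrow> 0"
    proof (rule row_sums_tendsto_in_prob[OF _ _ _ _ e, where u="\<lambda>n y. (J s n y - J s' n y) / sqrt (k n)"])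
      show "\<bar>(J s n y - J s' n y) / sqrt (k n)\<bar> \<le> 1 / sqrt (k n)" if "y \<in> space N" for n y
        by (simp add: J_def of_bool_def)
      have "(\<lambda>n. (n * q s n - k n) / sqrt (k n) - (n * q s' n - k n) / sqrt (k n)) \<longlonglongrightarrow> s - s'"
        by (intro tendsto_diff count)
      then show "(\<lambda>n. n * expectation (\<lambda>w. (J s n (Xs 1 w) - J s' n (Xs 1 w)) / sqrt (k n))) \<longlonglongrightarrow> s - s'"
        using iJ by (simp add: q right_diff_distrib diff_divide_distrib)
      show "(\<lambda>n. n * expectation (\<lambda>w. ((J s n (Xs 1 w) - J s' n (Xs 1 w)) / sqrt (k n))\<^sup>2)) \<longlonglongrightarrow> 0"
        using sq0[of "\<lambda>_. 1" 1 s s'] by simp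
    qed simp
    then show ?thesis by (simp add: Cnt_def sum_subtractf sum_divide_distrib diff_divide_distrib)
  qed
  have [measurable]: "S s n \<in> borel_measurable M" "Cnt s n \<in> borel_measurable M" for s n
    unfolding S_def[abs_def] Cnt_def[abs_def] by (auto intro!: borel_measurable_sum measurable_comp_Xs)
  \<comment> \<open>Multiplying by \<open>s\<close> treats both ends of the grid at once: the bad
    event is a count below \<open>k\<close> for positive \<open>s\<close>, or above \<open>k\<close>
    for negative \<open>s\<close>. It forces the normalized count to deviate by
    \<open>\<bar>s\<bar> / 2\<close> from its mean, which is itself within
    \<open>\<bar>s\<bar> / 2\<close> of \<open>s\<close>. Chebyshev's inequality gives the factor
    \<open>4 / s\<^sup>2\<close>, and the expected count, below \<open>5 / 4 * k\<close>, turns it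
    into \<open>5 / s\<^sup>2\<close>.\<close>
  have far: "\<forall>\<^sub>F n in sequentially. prob {w \<in> space M. (Cnt s n w - k n) * s < 0} < 5 / s\<^sup>2"
    if s: "s \<noteq> 0" for s
  proof -
    have "\<forall>\<^sub>F n in sequentially. n * q s n / k n < 5 / 4"
      using order_tendstoD(2)[OF qk, of "5/4"] by simp
    moreover have "\<forall>\<^sub>F n in sequentially. \<bar>(n * q s n - k n) / sqrt (k n) - s\<bar> < \<bar>s\<bar> / 2"
      using tendstoD[OF count, of "\<bar>s\<bar> / 2" s] s by (simp add: dist_real_def)
    ultimately show ?thesis using k_pos
    proof eventually_elim
      case (elim n)
      define m where "m = (n * q s n - k n) / sqrt (k n)"
      define a where "a = \<bar>s\<bar> / 2 * sqrt (k n)"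
      have sk0: "0 < sqrt (k n)" using elim by simp
      have Jsq: "(J s n y)\<^sup>2 = J s n y" for y by (simp add: J_def)
      have a: "0 < a" using elim s by (simp add: a_def)
      have incl: "{w \<in> space M. (Cnt s n w - k n) * s < 0}
          \<subseteq> {w \<in> space M. a \<le> \<bar>(\<Sum>l=1..n. J s n (Xs l w)) - n * expectation (\<lambda>w. J s n (Xs 1 w))\<bar>}"
      proof safe
        fix w assume "(Cnt s n w - k n) * s < 0"
        then have neg: "(Cnt s n w - k n) / sqrt (k n) * s < 0"
          using sk0 by (simp add: field_simps divide_less_0_iff)
        have "\<bar>s\<bar> / 2 \<le> \<bar>z - m\<bar>" if "z * s < 0" for z
          using that elim(2)[folded m_def] unfolding mult_less_0_iff by (smt (verit) field_sum_of_halves)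
        from this[OF neg] have "\<bar>s\<bar> / 2 \<le> \<bar>(Cnt s n w - k n) / sqrt (k n) - m\<bar>" .
        also have "(Cnt s n w - k n) / sqrt (k n) - m = (Cnt s n w - n * q s n) / sqrt (k n)"
          by (simp add: m_def diff_divide_distrib)
        finally show "a \<le> \<bar>(\<Sum>l=1..n. J s n (Xs l w)) - n * expectation (\<lambda>w. J s n (Xs 1 w))\<bar>"
          using sk0 by (simp add: a_def Cnt_def q field_simps)
      qed
      have "prob {w \<in> space M. (Cnt s n w - k n) * s < 0}
          \<le> prob {w \<in> space M. a \<le> \<bar>(\<Sum>l=1..n. J s n (Xs l w)) - n * expectation (\<lambda>w. J s n (Xs 1 w))\<bar>}"
        using \<open>Cnt s n \<in> borel_measurable M\<close>
        by (intro finite_measure_mono incl) (simp add: Cnt_def[abs_def])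
      also have "\<dots> \<le> n * expectation (\<lambda>w. (J s n (Xs 1 w))\<^sup>2) / a\<^sup>2"
        by (rule sum_deviation[OF J Jabs a])
      also have "\<dots> = 4 / s\<^sup>2 * (n * q s n / k n)"
        using elim s Jsq by (simp add: q a_def power_mult_distrib power_divide)
      also have "\<dots> < 4 / s\<^sup>2 * (5 / 4)"
        using s elim by (intro mult_strict_left_mono) auto
      finally show ?case by simp
    qed
  qed

  \<comment> \<open>Squeezing the random threshold between neighbouring grid levels\<close>
  have "(\<lambda>n. prob {w \<in> space M. e < \<bar>S 0 n w - Z n w\<bar>}) \<longlonglongrightarrow> 0" if e: "0 < e" for e
  proof (rule tendstoI)
    fix \<eta> :: real assume \<eta>: "0 < \<eta>"
    \<comment> \<open>Each of the four families of bad events gets a budget of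
      \<open>\<eta> / 4\<close>. Since \<open>L\<close> exceeds 1, \<open>L\<^sup>2\<close> exceeds
      \<open>20 / \<eta>\<close>, which keeps both ends of the grid within budget.\<close>
    define L where "L = 20 / \<eta> + 1"
    have L: "0 < L" using \<eta> by (simp add: L_def add_pos_pos)
    have "20 / \<eta> < L * L"
    proof -
      have "1 \<le> L" using \<eta> by (simp add: L_def)
      then have "L * 1 \<le> L * L" using L by (intro mult_left_mono) auto
      then show ?thesis by (simp add: L_def)
    qed
    then have L2: "5 / L\<^sup>2 < \<eta> / 4"
      using L \<eta> by (simp add: power2_eq_square field_simps)
    \<comment> \<open>The mesh \<open>d\<close> is made so small that a count gap of
      \<open>2 * d * sqrt k\<close> between neighbours, weighted by \<open>c\<close>, stays below
      \<open>e / 2 * sqrt k\<close>. The summand 1 next to \<open>\<bar>c\<bar>\<close> covers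
      \<open>c = 0\<close>.\<close>
    obtain m0 :: nat where m0: "2 * L * (4 * (\<bar>c\<bar> + 1)) / e \<le> m0" using real_arch_simple by blast
    define m where "m = Suc m0"
    define d where "d = 2 * L / m"
    have d: "0 < d" using L by (simp add: d_def m_def)
    have "2 * L * (4 * (\<bar>c\<bar> + 1)) / e \<le> m" using m0 by (simp add: m_def)
    then have "d * (4 * (\<bar>c\<bar> + 1)) \<le> e"
      using e by (simp add: d_def m_def field_simps)
    then have dc: "\<bar>c\<bar> * (2 * d) \<le> e / 2" using d by (simp add: algebra_simps)
    define s where "s j = - L + real j * d" for j
    have s0: "s 0 = - L" by (simp add: s_def)
    have sm: "s m = L" by (simp add: s_def d_def m_def)
    define E1 where "E1 n = {w \<in> space M. (Cnt (- L) n w - k n) * (- L) < 0}" for n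
    define E2 where "E2 n = {w \<in> space M. (Cnt L n w - k n) * L < 0}" for n
    define E3 where "E3 n j = {w \<in> space M. e / 2 < \<bar>S (s j) n w - S 0 n w\<bar>}" for n j
    define E4 where "E4 n j = {w \<in> space M. d < \<bar>(Cnt (s (Suc j)) n w - Cnt (s j) n w) / sqrt (k n) - (s (Suc j) - s j)\<bar>}" for n j
    have meas: "E1 n \<in> events" "E2 n \<in> events" "E3 n j \<in> events" "E4 n j \<in> events" for n j
      unfolding E1_def E2_def E3_def E4_def by measurable
    have p3: "\<forall>\<^sub>F n in sequentially. (\<Sum>j\<le>m. prob (E3 n j)) < \<eta> / 4"
    proof (rule order_tendstoD(2))
      show "(\<lambda>n. \<Sum>j\<le>m. prob (E3 n j)) \<longlonglongrightarrow> (\<Sum>j\<le>m. 0)"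
        unfolding E3_def using e by (intro tendsto_sum closeS) simp
    qed (use \<eta> in simp)
    have p4: "\<forall>\<^sub>F n in sequentially. (\<Sum>j<m. prob (E4 n j)) < \<eta> / 4"
    proof (rule order_tendstoD(2))
      show "(\<lambda>n. \<Sum>j<m. prob (E4 n j)) \<longlonglongrightarrow> (\<Sum>j<m. 0)"
        unfolding E4_def using d by (intro tendsto_sum closeN) simp
    qed (use \<eta> in simp)
    have p1: "\<forall>\<^sub>F n in sequentially. prob (E1 n) < 5 / L\<^sup>2"
      using far[of "- L"] L unfolding E1_def by simp
    have p2: "\<forall>\<^sub>F n in sequentially. prob (E2 n) < 5 / L\<^sup>2"
      using far[of L] L unfolding E2_def by simp
    have xp: "\<forall>\<^sub>F n in sequentially. \<forall>j\<in>{..m}. 0 < x (s j) n"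
      by (intro eventually_ball_finite ballI x_pos) simp
    show "\<forall>\<^sub>F n in sequentially. dist (prob {w \<in> space M. e < \<bar>S 0 n w - Z n w\<bar>}) 0 < \<eta>"
      using p1 p2 p3 p4 k_pos k_le Z xp
    proof eventually_elim
      case (elim n)
      have sk0: "0 < sqrt (k n)" using elim by simp
      \<comment> \<open>The inclusion is deterministic: off the bad events the counts cross
        \<open>k\<close> between two neighbouring grid levels, and the sandwich applies to that
        outcome.\<close>
      have "{w \<in> space M. e < \<bar>S 0 n w - Z n w\<bar>}
          \<subseteq> E1 n \<union> E2 n \<union> (\<Union>j\<le>m. E3 n j) \<union> (\<Union>j<m. E4 n j)"
      proof (rule subsetI, rule ccontr)
        fix w assume "w \<in> {w \<in> space M. e < \<bar>S 0 n w - Z n w\<bar>}"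
        then have w: "w \<in> space M" and far': "e < \<bar>S 0 n w - Z n w\<bar>" by auto
        assume good: "w \<notin> E1 n \<union> E2 n \<union> (\<Union>j\<le>m. E3 n j) \<union> (\<Union>j<m. E4 n j)"
        define r where "r l = \<rho> (Xs l w)" for l
        have ex: "exceedances r n (x z n) = Cnt z n w" for z
          by (simp add: exceedances_def Cnt_def J_def r_def)
        have "Cnt (s 0) n w \<le> k n" "k n \<le> Cnt (s m) n w"
          using good w L unfolding s0 sm by (auto simp: E1_def E2_def mult_less_0_iff mult_le_0_iff not_less)
        from discrete_crossing[where g="\<lambda>j. Cnt (s j) n w", OF this]
        obtain j where j: "j < m" "Cnt (s j) n w \<le> k n" "k n \<le> Cnt (s (Suc j)) n w"
          by (auto simp: m_def)
        define A where "A y = (\<Sum>l=1..n. \<phi> (Xs l w) * of_bool (y \<le> r l))" for y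
        define K where "K = kth_largest (k n) (map r [1..<n + 1])"
        have pos: "0 < x (s (Suc j)) n" using elim(8) j by simp
        have nn: "0 \<le> \<phi> (Xs l w)" if "l \<in> {1..n}" "0 < r l" for l
          using that nonneg[of "Xs l w"] measurable_space[OF measurable_Xs w, of l] by (simp add: r_def)
        have sand: "A (x (s j) n) \<le> A K" "A K \<le> A (x (s (Suc j)) n)"
          unfolding A_def K_def
          using kth_largest_sum_sandwich[where \<phi>="\<lambda>l. \<phi> (Xs l w)" and r=r, OF elim(5) elim(6) nn pos, of "x (s j) n"] j
          by (auto simp: ex)
        \<comment> \<open>The sums \<open>A\<close> of nonnegative terms obey the sandwich, the
          centred sums \<open>S\<close> have the limit law; this identity passes between
          them.\<close>
        have AS: "A (x z n) = sqrt (k n) * S z n w + c * Cnt z n w" for z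
        proof -
          have "sqrt (k n) * S z n w = (\<Sum>l=1..n. (\<phi> (Xs l w) - c) * J z n (Xs l w))"
            unfolding S_def W_def sum_distrib_left using sk0 by (intro sum.cong refl) simp
          then show ?thesis
            unfolding A_def Cnt_def sum_distrib_left
            by (simp only: sum.distrib[symmetric]) (intro sum.cong refl, simp add: J_def r_def algebra_simps)
        qed
        have ZK: "sqrt (k n) * Z n w = A K - c * k n"
        proof -
          have "r = (\<lambda>l. \<rho> (Xs l w))" by (simp add: r_def fun_eq_iff)
          then show ?thesis using elim(7) w sk0 by (simp add: A_def K_def)
        qed
        have g3: "\<bar>S (s i) n w - S 0 n w\<bar> \<le> e / 2" if "i \<le> m" for i
          using good that w by (auto simp: E3_def not_less)
        have "\<bar>(Cnt (s (Suc j)) n w - Cnt (s j) n w) / sqrt (k n) - (s (Suc j) - s j)\<bar> \<le> d"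
          using good j w by (auto simp: E4_def not_less)
        moreover have "s (Suc j) - s j = d" by (simp add: s_def algebra_simps)
        ultimately have "(Cnt (s (Suc j)) n w - Cnt (s j) n w) / sqrt (k n) \<le> 2 * d" by linarith
        then have gap: "Cnt (s (Suc j)) n w - Cnt (s j) n w \<le> 2 * d * sqrt (k n)"
          using sk0 by (simp add: field_simps)
        \<comment> \<open>Since \<open>k\<close> lies between the two neighbouring counts, its
          distance from either is at most their gap.\<close>
        have cgap: "\<bar>c * (Cnt (s i) n w - k n)\<bar> \<le> sqrt (k n) * (e / 2)" if "i = j \<or> i = Suc j" for i
        proof -
          have "\<bar>c * (Cnt (s i) n w - k n)\<bar> \<le> \<bar>c\<bar> * (2 * d * sqrt (k n))"
            unfolding abs_mult using gap j that by (intro mult_left_mono) auto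
          also have "\<dots> \<le> sqrt (k n) * (e / 2)"
            using mult_left_mono[OF dc, of "sqrt (k n)"] by (simp add: algebra_simps)
          finally show ?thesis .
        qed
        have Sd: "\<bar>sqrt (k n) * (S (s i) n w - S 0 n w)\<bar> \<le> sqrt (k n) * (e / 2)" if "i \<le> m" for i
          unfolding abs_mult using mult_left_mono[OF g3[OF that], of "sqrt (k n)"] by simp
        have "\<bar>sqrt (k n) * (Z n w - S 0 n w)\<bar> \<le> sqrt (k n) * (e / 2) + sqrt (k n) * (e / 2)"
          using sand cgap[of j] cgap[of "Suc j"] Sd[OF less_imp_le[OF j(1)]] Sd[OF Suc_leI[OF j(1)]] ZK
          unfolding AS right_diff_distrib by linarith
        then have "sqrt (k n) * \<bar>Z n w - S 0 n w\<bar> \<le> sqrt (k n) * e"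
          by (simp add: abs_mult mult.commute)
        then have "\<bar>Z n w - S 0 n w\<bar> \<le> e" using sk0 by simp
        with far' show False by (simp add: abs_minus_commute)
      qed
      then have "prob {w \<in> space M. e < \<bar>S 0 n w - Z n w\<bar>}
          \<le> prob (E1 n \<union> E2 n \<union> (\<Union>j\<le>m. E3 n j) \<union> (\<Union>j<m. E4 n j))"
        using meas by (intro finite_measure_mono) auto
      also have "\<dots> \<le> prob (E1 n) + prob (E2 n) + prob (\<Union>j\<le>m. E3 n j) + prob (\<Union>j<m. E4 n j)"
        using meas by (intro measure_subadditive[THEN order_trans] add_mono order_refl) auto
      also have "prob (\<Union>j\<le>m. E3 n j) \<le> (\<Sum>j\<le>m. prob (E3 n j))"
        using meas by (intro finite_measure_subadditive_finite) auto
      also have "prob (\<Union>j<m. E4 n j) \<le> (\<Sum>j<m. prob (E4 n j))"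
        using meas by (intro finite_measure_subadditive_finite) auto
      finally have "prob {w \<in> space M. e < \<bar>S 0 n w - Z n w\<bar>} < \<eta>"
        using elim L2 by linarith
      then show ?case by simp
    qed
  qed
  from char_tendsto_perturbation[OF _ _ this charS] show ?thesis by simp
qed

end

section \<open>Consequences of regular variation\<close>

text \<open>A continuous substitute for the indicator of an upper half-line, as vague convergence
  tests only continuous functions. Clamping to \<open>[a, b]\<close> comes before
  \<open>real_of_ereal\<close>, which sends \<infinity> to 0 and would destroy continuity
  there.\<close>

definition ramp :: "real \<Rightarrow> real \<Rightarrow> ereal \<Rightarrow> real" where
  "ramp a b r = (real_of_ereal (min (ereal b) (max (ereal a) r)) - a) / (b - a)"

lemma continuous_on_ramp:
  assumes "a < b"
  shows "continuous_on UNIV (ramp a b)"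
proof -
  have "continuous_on (UNIV - {\<infinity>, -\<infinity>}) real_of_ereal"
    by (rule continuous_on_real)
  then have "continuous_on UNIV (\<lambda>r. real_of_ereal (min (ereal b) (max (ereal a) r)))"
  proof (rule continuous_on_compose2)
    show "continuous_on UNIV (\<lambda>r. min (ereal b) (max (ereal a) r))"
      by (intro continuous_intros)
  qed (auto simp: min_def max_def)
  then show ?thesis
    unfolding ramp_def[abs_def] using assms by (intro continuous_intros) auto
qed

lemma ramp_cases:
  assumes "a < b"
  shows "r \<le> ereal a \<Longrightarrow> ramp a b r = 0" "ereal b \<le> r \<Longrightarrow> ramp a b r = 1"
    "0 \<le> ramp a b r" "ramp a b r \<le> 1"
proof -
  show "r \<le> ereal a \<Longrightarrow> ramp a b r = 0" "ereal b \<le> r \<Longrightarrow> ramp a b r = 1"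
    using assms by (cases r; auto simp: ramp_def max_def min_def)+
  show "0 \<le> ramp a b r" "ramp a b r \<le> 1"
    using assms by (cases r; simp add: ramp_def max_def min_def field_simps)+
qed

lemma ramp_bounds:
  assumes "a < b"
  shows "indicator {ereal b..} r \<le> ramp a b r" "ramp a b r \<le> indicator {ereal a..} r"
  using ramp_cases[OF assms, of r] by (auto simp: indicator_def)

lemma borel_measurable_ramp[measurable]:
  assumes "a < b" shows "ramp a b \<in> borel_measurable borel"
  using borel_measurable_continuous_onI[OF continuous_on_ramp[OF assms]] .

lemma sets_nu2: "sets nu2 = sets (restrict_space borel {0<..})"
  unfolding nu2_def by (intro sets_restrict_space_cong) simp

lemma emeasure_nu2_atLeast:
  assumes "0 < a"
  shows "emeasure nu2 {ereal a..} = ennreal (1 / a\<^sup>2)"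
proof -
  have sub: "{ereal a..} \<subseteq> {0<..}" using assms by (auto intro: less_le_trans[of 0 "ereal a"])
  have "emeasure nu2 {ereal a..}
      = emeasure (distr (density lborel (\<lambda>x. ennreal (2 * x powr (-3)) * indicator {0<..} x)) borel ereal) {ereal a..}"
    unfolding nu2_def using sub by (intro emeasure_restrict_space) auto
  also have "\<dots> = emeasure (density lborel (\<lambda>x. ennreal (2 * x powr (-3)) * indicator {0<..} x)) {a..}"
    by (subst emeasure_distr) (auto intro!: arg_cong2[where f=emeasure])
  also have "\<dots> = (\<integral>\<^sup>+x. ennreal (2 * x powr (-3)) * indicator {0<..} x * indicator {a..} x \<partial>lborel)"
    by (subst emeasure_density) auto
  also have "\<dots> = (\<integral>\<^sup>+x. ennreal (2 * x powr (-3)) * indicator {a..} x \<partial>lborel)"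
    using assms by (intro nn_integral_cong) (auto simp: indicator_def)
  also have "\<dots> = 0 - (- (a powr (-2)))"
  proof (rule nn_integral_FTC_atLeast)
    show "((\<lambda>x. - (x powr (-2))) has_real_derivative 2 * x powr (-3)) (at x)" if "a \<le> x" for x
      using that assms by (auto intro!: derivative_eq_intros)
    have "((\<lambda>x::real. x powr (-2)) \<longlongrightarrow> 0) at_top"
      by (intro tendsto_neg_powr filterlim_ident) simp
    then show "((\<lambda>x::real. - (x powr (-2))) \<longlongrightarrow> 0) at_top"
      using tendsto_minus by fastforce
  qed auto
  also have "a powr (-2) = 1 / a\<^sup>2"
    using assms by (simp add: powr_minus divide_inverse)
  finally show ?thesis by simp
qed

lemma compact_nonneg_sphere: "compact (nonneg_sphere :: (real ^ 'd) set)"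
proof -
  have "nonneg_sphere = sphere 0 1 \<inter> (\<Inter>i. {x :: real ^ 'd. 0 \<le> x $ i})"
    by (auto simp: nonneg_sphere_def nonneg_orthant_def)
  also have "compact \<dots>"
    by (intro compact_Int_closed closed_INT ballI closed_Collect_le continuous_intros) auto
  finally show ?thesis .
qed

lemma closed_nonneg_orthant: "closed (nonneg_orthant :: (real ^ 'd) set)"
proof -
  have "nonneg_orthant = (\<Inter>i. {x :: real ^ 'd. 0 \<le> x $ i})"
    by (auto simp: nonneg_orthant_def)
  also have "closed \<dots>"
    by (intro closed_INT ballI closed_Collect_le continuous_intros)
  finally show ?thesis .
qed

lemma angle_in_nonneg_sphere:
  assumes "x \<in> nonneg_orthant" "0 < norm x"
  shows "angle x \<in> nonneg_sphere"
  using assms by (simp add: angle_def nonneg_sphere_def nonneg_orthant_def)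

lemma borel_measurable_nonneg_sphere: "nonneg_sphere \<in> sets (borel :: (real ^ 'd) measure)"
  using compact_nonneg_sphere by (intro borel_compact)

lemma sets_polar_space: "polar_space \<in> sets (borel :: (ereal \<times> (real ^ 'd)) measure)"
  unfolding polar_space_def borel_prod[symmetric]
  by (intro pair_measureI borel_measurable_nonneg_sphere) auto

lemma borel_measurable_angle[measurable]: "angle \<in> borel_measurable borel"
  unfolding angle_def[abs_def] by measurable

lemma borel_measurable_indicator_nonneg_sphere:
  fixes g :: "real ^ 'd \<Rightarrow> real"
  assumes "continuous_on nonneg_sphere g"
  shows "(\<lambda>x. indicator nonneg_sphere x * g x) \<in> borel_measurable borel"
  using borel_measurable_continuous_on_indicator[OF borel_measurable_nonneg_sphere assms] by simp

lemma bounded_on_nonneg_sphere: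
  fixes g :: "real ^ 'd \<Rightarrow> real"
  assumes "continuous_on nonneg_sphere g"
  obtains B where "0 \<le> B" "\<And>x. x \<in> nonneg_sphere \<Longrightarrow> \<bar>g x\<bar> \<le> B"
proof -
  have "compact (g ` nonneg_sphere)"
    by (intro compact_continuous_image assms compact_nonneg_sphere)
  then obtain B where "\<forall>y\<in>g ` nonneg_sphere. \<bar>y\<bar> \<le> B"
    using compact_imp_bounded bounded_real by blast
  then have "\<bar>g x\<bar> \<le> max 0 B" if "x \<in> nonneg_sphere" for x
    using that by fastforce
  then show ?thesis using that[of "max 0 B"] by simp
qed

locale regular_variation = prob_space M for M :: "'w measure" +
  fixes X :: "'w \<Rightarrow> real ^ 'd" and b :: "nat \<Rightarrow> real" and H :: "(real ^ 'd) measure"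
  assumes RV: "regularly_varying2 M X b H"
begin

lemma X_measurable: "X \<in> M \<rightarrow>\<^sub>M restrict_space borel nonneg_orthant"
  using RV by (simp add: regularly_varying2_def)

lemma X_borel[measurable]: "X \<in> borel_measurable M"
  using X_measurable by (simp add: measurable_restrict_space2_iff)

lemma X_in_orthant: "w \<in> space M \<Longrightarrow> X w \<in> nonneg_orthant"
  using measurable_space[OF X_measurable] by (simp add: space_restrict_space)

lemma b_at_top: "filterlim b at_top sequentially"
  using RV by (simp add: regularly_varying2_def)

lemma b_pos: "\<forall>\<^sub>F n in sequentially. 0 < b n"
  using b_at_top by (auto simp: filterlim_at_top_dense)

lemma finite_H: "finite_measure H"
  using RV by (simp add: regularly_varying2_def)

lemma sets_H: "sets H = sets (restrict_space borel nonneg_sphere)"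
  using RV by (simp add: regularly_varying2_def)

lemma space_H: "space H = nonneg_sphere"
  using sets_eq_imp_space_eq[OF sets_H] by (simp add: space_restrict_space)

lemma vague: "vague_conv_on polar_space (scaled_polar_law M X b) (nu2 \<Otimes>\<^sub>M H)"
  using RV by (simp add: regularly_varying2_def)

context
  fixes g :: "real ^ 'd \<Rightarrow> real"
  assumes g_cont: "continuous_on nonneg_sphere g"
    and g_nonneg: "\<And>x. x \<in> nonneg_sphere \<Longrightarrow> 0 \<le> g x"
begin

lemma g_measurable_H: "g \<in> borel_measurable H"
  unfolding measurable_cong_sets[OF sets_H refl]
  using g_cont by (rule borel_measurable_continuous_on_restrict)

lemma g_integrable_H: "integrable H g"
proof -
  interpret finite_measure H by (rule finite_H)
  obtain B where "0 \<le> B" "\<And>x. x \<in> nonneg_sphere \<Longrightarrow> \<bar>g x\<bar> \<le> B"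
    using bounded_on_nonneg_sphere[OF g_cont] by blast
  then show ?thesis
    using g_nonneg by (intro integrable_const_bound[where B=B] g_measurable_H AE_I2) (auto simp: space_H)
qed

text \<open>A positive level excludes the origin, whose angle lies off the sphere and where nothing
  is known about \<open>g\<close>.\<close>

lemma integrable_tail:
  assumes "0 < y"
  shows "integrable M (\<lambda>w. g (angle (X w)) * of_bool (y \<le> norm (X w)))"
proof -
  obtain B where B: "0 \<le> B" "\<And>x. x \<in> nonneg_sphere \<Longrightarrow> \<bar>g x\<bar> \<le> B"
    using bounded_on_nonneg_sphere[OF g_cont] by blast
  have eq: "g (angle (X w)) * of_bool (y \<le> norm (X w))
      = indicator nonneg_sphere (angle (X w)) * g (angle (X w)) * of_bool (y \<le> norm (X w))"
    if "w \<in> space M" for w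
    using angle_in_nonneg_sphere[OF X_in_orthant[OF that]] assms
    by (cases "X w = 0") auto
  have [measurable]: "(\<lambda>w. indicator nonneg_sphere (angle (X w)) * g (angle (X w))) \<in> borel_measurable M"
    by (rule measurable_compose[OF _ borel_measurable_indicator_nonneg_sphere[OF g_cont]]) measurable
  have "integrable M (\<lambda>w. indicator nonneg_sphere (angle (X w)) * g (angle (X w)) * of_bool (y \<le> norm (X w)))"
  proof (rule integrable_const_bound[where B=B])
    show "AE w in M. norm (indicator nonneg_sphere (angle (X w)) * g (angle (X w)) * of_bool (y \<le> norm (X w))) \<le> B"
      using B g_nonneg by (intro AE_I2) (auto simp: indicator_def of_bool_def)
  qed measurable
  then show ?thesis
    by (rule Bochner_Integration.integrable_cong[THEN iffD1, rotated -1]) (auto simp: eq)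
qed

text \<open>The test function is a ramp in the radius times \<open>g\<close> in the angle. Its
  support lies in \<open>{ereal a..} \<times> nonneg_sphere\<close>, which is compact because
  \<infinity> belongs to the radial space. The limit factorizes, and enclosing the ramp between two
  half-line indicators gives bounds that suffice for the later squeeze.\<close>

lemma ramp_limit:
  assumes a: "0 < a" "a < a'"
  obtains I where "(\<lambda>n. n * expectation (\<lambda>w. ramp a a' (ereal (norm (X w) / b n)) * (indicator nonneg_sphere (angle (X w)) * g (angle (X w))))) \<longlonglongrightarrow> I"
    "integral\<^sup>L H g / a'\<^sup>2 \<le> I" "I \<le> integral\<^sup>L H g / a\<^sup>2"
proof -
  interpret H: finite_measure H by (rule finite_H)
  \<comment> \<open>Extension by 0 makes the angular factor measurable and nonnegative everywhere,
    although \<open>g\<close> is controlled only on the sphere.\<close>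
  define g' where "g' x = indicator nonneg_sphere x * g x" for x
  define G where "G z = ramp a a' (fst z) * g' (snd z)" for z :: "ereal \<times> (real ^ 'd)"
  have g'[measurable]: "g' \<in> borel_measurable borel"
    unfolding g'_def[abs_def] by (rule borel_measurable_indicator_nonneg_sphere[OF g_cont])
  have g'0: "0 \<le> g' x" for x using g_nonneg by (auto simp: g'_def indicator_def)
  note [measurable] = borel_measurable_ramp[OF a(2)]
  note r = ramp_cases[OF a(2)]
  have G0: "0 \<le> G z" for z by (simp add: G_def g'0 r(3))
  have Gm[measurable]: "G \<in> borel_measurable borel"
    unfolding G_def[abs_def] borel_prod[symmetric] by measurable
  have G_cont: "continuous_on polar_space G"
  proof -
    have "continuous_on polar_space (\<lambda>z. ramp a a' (fst z) * g (snd z))"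
      by (intro continuous_intros continuous_on_compose2[OF continuous_on_ramp[OF a(2)]]
          continuous_on_compose2[OF g_cont]) (auto simp: polar_space_def)
    then show ?thesis
      by (rule continuous_on_eq) (auto simp: G_def g'_def polar_space_def)
  qed
  define K where "K = {ereal a..} \<times> (nonneg_sphere :: (real ^ 'd) set)"
  have K: "compact K" "K \<subseteq> polar_space" "\<forall>z\<in>polar_space - K. G z = 0"
  proof -
    show "compact K"
      unfolding K_def by (intro compact_Times compact_nonneg_sphere) (simp add: compact_eq_closed)
    show "K \<subseteq> polar_space"
      unfolding K_def polar_space_def using a by (auto intro: less_le_trans[of 0 "ereal a"])
    have "ereal a \<le> r" if "ramp a a' r \<noteq> 0" for r
      using that r(1)[of r] by (metis linear)
    then show "\<forall>z\<in>polar_space - K. G z = 0"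
      by (auto simp: K_def polar_space_def G_def)
  qed
  have lim: "(\<lambda>n. integral\<^sup>L (scaled_polar_law M X b n) G) \<longlonglongrightarrow> integral\<^sup>L (nu2 \<Otimes>\<^sub>M H) G"
    using vague G_cont K unfolding vague_conv_on_def by blast
  have scaled: "\<forall>\<^sub>F n in sequentially. integral\<^sup>L (scaled_polar_law M X b n) G
      = n * expectation (\<lambda>w. ramp a a' (ereal (norm (X w) / b n)) * g' (angle (X w)))"
    using b_pos
  proof eventually_elim
    case (elim n)
    define P where "P w = (ereal (norm (X w) / b n), angle (X w))" for w
    have [measurable]: "P \<in> borel_measurable M"
      unfolding P_def[abs_def] borel_prod[symmetric] by measurable
    have law: "scaled_polar_law M X b n = scale_measure (of_nat n) (restrict_space (distr M borel P) polar_space)"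
      by (simp add: scaled_polar_law_def P_def[abs_def])
    have Gr: "G \<in> borel_measurable (restrict_space (distr M borel P) polar_space)"
      by (rule measurable_restrict_space1) simp
    have "integral\<^sup>L (scaled_polar_law M X b n) G = enn2real (\<integral>\<^sup>+z. G z \<partial>scaled_polar_law M X b n)"
      unfolding law using Gr G0
      by (intro integral_eq_nn_integral) (auto simp: measurable_cong_sets[OF sets_scale_measure refl])
    also have "(\<integral>\<^sup>+z. G z \<partial>scaled_polar_law M X b n) = of_nat n * (\<integral>\<^sup>+z. G z \<partial>restrict_space (distr M borel P) polar_space)"
      unfolding law using Gr by (intro nn_integral_scale_measure) auto
    also have "(\<integral>\<^sup>+z. G z \<partial>restrict_space (distr M borel P) polar_space)
        = (\<integral>\<^sup>+z. ennreal (G z) * indicator polar_space z \<partial>distr M borel P)"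
      using sets_polar_space by (intro nn_integral_restrict_space) auto
    also have "\<dots> = (\<integral>\<^sup>+w. ennreal (G (P w)) * indicator polar_space (P w) \<partial>M)"
      using sets_polar_space
      by (intro nn_integral_distr borel_measurable_times_ennreal borel_measurable_indicator measurable_compose[OF Gm]) auto
    \<comment> \<open>Restriction to \<open>polar_space\<close> removes only the event that
      \<open>X\<close> is 0, where the ramp vanishes anyway.\<close>
    also have "\<dots> = (\<integral>\<^sup>+w. G (P w) \<partial>M)"
    proof (rule nn_integral_cong)
      fix w assume w: "w \<in> space M"
      show "ennreal (G (P w)) * indicator polar_space (P w) = ennreal (G (P w))"
      proof (cases "X w = 0")
        case True
        then show ?thesis using a r(1)[of "ereal 0"] by (simp add: G_def P_def)
      next
        case False
        then show ?thesis
          using elim angle_in_nonneg_sphere[OF X_in_orthant[OF w]] by (simp add: P_def polar_space_def)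
      qed
    qed
    also have "enn2real (of_nat n * (\<integral>\<^sup>+w. G (P w) \<partial>M)) = n * enn2real (\<integral>\<^sup>+w. G (P w) \<partial>M)"
      by (simp add: enn2real_mult)
    also have "enn2real (\<integral>\<^sup>+w. G (P w) \<partial>M) = expectation (\<lambda>w. G (P w))"
      using G0 by (intro integral_eq_nn_integral[symmetric]) auto
    also have "\<dots> = expectation (\<lambda>w. ramp a a' (ereal (norm (X w) / b n)) * g' (angle (X w)))"
      by (simp add: G_def P_def)
    finally show ?case .
  qed
  have sets_pair: "sets (nu2 \<Otimes>\<^sub>M H) = sets (restrict_space borel {0<..} \<Otimes>\<^sub>M restrict_space borel nonneg_sphere)"
    by (intro sets_pair_measure_cong sets_nu2 sets_H)
  have ramp_nu2: "ramp a a' \<in> borel_measurable nu2"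
    unfolding measurable_cong_sets[OF sets_nu2 refl] by (rule measurable_restrict_space1) simp
  have g'H: "g' \<in> borel_measurable H"
    unfolding measurable_cong_sets[OF sets_H refl] by (rule measurable_restrict_space1) simp
  have GP: "G \<in> borel_measurable (nu2 \<Otimes>\<^sub>M H)"
    unfolding G_def[abs_def]
    by (intro borel_measurable_times measurable_compose[OF measurable_fst ramp_nu2]
        measurable_compose[OF measurable_snd g'H])
  define \<rho> where "\<rho> = (\<integral>\<^sup>+r. ramp a a' r \<partial>nu2)"
  have intg: "integral\<^sup>L H g = integral\<^sup>L H g'"
    by (intro Bochner_Integration.integral_cong refl) (simp add: g'_def space_H)
  have g'int: "integrable H g'"
    using g_integrable_H by (rule Bochner_Integration.integrable_cong[THEN iffD1, rotated -1])
      (auto simp: g'_def space_H)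
  have "(\<integral>\<^sup>+z. G z \<partial>(nu2 \<Otimes>\<^sub>M H)) = (\<integral>\<^sup>+r. \<integral>\<^sup>+x. G (r, x) \<partial>H \<partial>nu2)"
    using GP by (intro H.nn_integral_fst[symmetric]) auto
  also have "\<dots> = (\<integral>\<^sup>+r. ramp a a' r * (\<integral>\<^sup>+x. g' x \<partial>H) \<partial>nu2)"
    using g'H g'0 r(3) by (simp add: G_def ennreal_mult nn_integral_cmult)
  also have "\<dots> = \<rho> * (\<integral>\<^sup>+x. g' x \<partial>H)"
    unfolding \<rho>_def using ramp_nu2 by (intro nn_integral_multc) auto
  also have "(\<integral>\<^sup>+x. g' x \<partial>H) = ennreal (integral\<^sup>L H g)"
    unfolding intg using g'int g'0 by (intro nn_integral_eq_integral) auto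
  finally have nn: "(\<integral>\<^sup>+z. G z \<partial>(nu2 \<Otimes>\<^sub>M H)) = \<rho> * ennreal (integral\<^sup>L H g)" .
  have Ig: "integral\<^sup>L (nu2 \<Otimes>\<^sub>M H) G = enn2real \<rho> * integral\<^sup>L H g"
    using GP G0 nn g'0 by (subst integral_eq_nn_integral) (auto simp: enn2real_mult intg)
  have ic: "{ereal c..} \<in> sets nu2" if "0 < c" for c
    unfolding sets_nu2 using that by (subst sets_restrict_space_iff) (auto intro: less_le_trans[of 0 "ereal c"])
  have "\<rho> \<le> (\<integral>\<^sup>+r. indicator {ereal a..} r \<partial>nu2)"
    unfolding \<rho>_def using ramp_bounds(2)[OF a(2)]
    by (intro nn_integral_mono) (metis ennreal_indicator ennreal_leI)
  then have up: "\<rho> \<le> ennreal (1 / a\<^sup>2)"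
    using ic[OF a(1)] emeasure_nu2_atLeast[OF a(1)] by simp
  have "(\<integral>\<^sup>+r. indicator {ereal a'..} r \<partial>nu2) \<le> \<rho>"
    unfolding \<rho>_def using ramp_bounds(1)[OF a(2)]
    by (intro nn_integral_mono) (metis ennreal_indicator ennreal_leI)
  then have lo: "ennreal (1 / a'\<^sup>2) \<le> \<rho>"
    using ic[of a'] emeasure_nu2_atLeast[of a'] a by simp
  have fin: "\<rho> < top" using up by (auto simp: less_top[symmetric] top_unique)
  have e: "enn2real \<rho> \<le> 1 / a\<^sup>2" "1 / a'\<^sup>2 \<le> enn2real \<rho>"
    using enn2real_mono[OF up] enn2real_mono[OF lo fin] by auto
  have Ig0: "0 \<le> integral\<^sup>L H g" unfolding intg using g'0 by simp
  show ?thesis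
  proof (rule that)
    show "(\<lambda>n. n * expectation (\<lambda>w. ramp a a' (ereal (norm (X w) / b n)) * (indicator nonneg_sphere (angle (X w)) * g (angle (X w)))))
        \<longlonglongrightarrow> enn2real \<rho> * integral\<^sup>L H g"
      using Lim_transform_eventually[OF lim scaled] unfolding Ig g'_def .
    show "integral\<^sup>L H g / a'\<^sup>2 \<le> enn2real \<rho> * integral\<^sup>L H g" 
      using mult_right_mono[OF e(2) Ig0] by simp
    show "enn2real \<rho> * integral\<^sup>L H g \<le> integral\<^sup>L H g / a\<^sup>2"
      using mult_right_mono[OF e(1) Ig0] by simp
  qed
qed

text \<open>The indicator of the half-line from \<open>y\<close> lies between a ramp that starts at
  \<open>y\<close> and one that ends there. Letting the other end of each ramp approach
  \<open>y\<close> closes the gap, by continuity of \<open>integral\<^sup>L H g / a\<^sup>2\<close>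
  in \<open>a\<close>.\<close>

theorem tail_expectation_tendsto:
  assumes y: "0 < y"
  shows "(\<lambda>n. n * expectation (\<lambda>w. g (angle (X w)) * of_bool (b n * y \<le> norm (X w)))) \<longlonglongrightarrow> integral\<^sup>L H g / y\<^sup>2"
proof -
  define T where "T n = expectation (\<lambda>w. g (angle (X w)) * of_bool (b n * y \<le> norm (X w)))" for n
  define Q where "Q a a' n = expectation (\<lambda>w. ramp a a' (ereal (norm (X w) / b n)) * (indicator nonneg_sphere (angle (X w)) * g (angle (X w))))" for a a' n
  obtain B where B: "0 \<le> B" "\<And>x. x \<in> nonneg_sphere \<Longrightarrow> \<bar>g x\<bar> \<le> B"
    using bounded_on_nonneg_sphere[OF g_cont] by blast
  have intQ: "integrable M (\<lambda>w. ramp a a' (ereal (norm (X w) / b n)) * (indicator nonneg_sphere (angle (X w)) * g (angle (X w))))"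
    if "a < a'" for a a' n
  proof (rule integrable_const_bound[where B=B])
    note [measurable] = borel_measurable_ramp[OF that]
    have [measurable]: "(\<lambda>w. indicator nonneg_sphere (angle (X w)) * g (angle (X w))) \<in> borel_measurable M"
      by (rule measurable_compose[OF _ borel_measurable_indicator_nonneg_sphere[OF g_cont]]) measurable
    show "(\<lambda>w. ramp a a' (ereal (norm (X w) / b n)) * (indicator nonneg_sphere (angle (X w)) * g (angle (X w)))) \<in> borel_measurable M"
      by measurable
    have "norm (ramp a a' (ereal (norm (X w) / b n)) * (indicator nonneg_sphere (angle (X w)) * g (angle (X w)))) \<le> 1 * B" for w
      unfolding norm_mult using B g_nonneg ramp_cases(3,4)[OF that]
      by (intro mult_mono) (auto simp: indicator_def)
    then show "AE w in M. norm (ramp a a' (ereal (norm (X w) / b n)) * (indicator nonneg_sphere (angle (X w)) * g (angle (X w)))) \<le> B"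
      by simp
  qed
  have intT: "integrable M (\<lambda>w. g (angle (X w)) * of_bool (b n * y \<le> norm (X w)))" if "0 < b n" for n
    using integrable_tail[of "b n * y"] that y by simp
  have pw: "indicator nonneg_sphere (angle (X w)) * g (angle (X w)) * of_bool (b n * y \<le> norm (X w))
      = g (angle (X w)) * of_bool (b n * y \<le> norm (X w))" if "0 < b n" "w \<in> space M" for n w
    using angle_in_nonneg_sphere[OF X_in_orthant[OF that(2)]] y mult_pos_pos[OF that(1) y]
    by (cases "X w = 0") (auto simp: not_le[symmetric])
  have g0: "0 \<le> indicator nonneg_sphere x * g x" for x using g_nonneg by (auto simp: indicator_def)
  have "of_bool (b n * y \<le> norm (X w)) = (indicator {ereal y..} (ereal (norm (X w) / b n)) :: real)" if "0 < b n" for n w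
    using that by (auto simp: indicator_def field_simps)
  then have tail: "g (angle (X w)) * of_bool (b n * y \<le> norm (X w))
      = indicator {ereal y..} (ereal (norm (X w) / b n)) * (indicator nonneg_sphere (angle (X w)) * g (angle (X w)))"
    if "0 < b n" "w \<in> space M" for n w
    using pw[OF that] that(1) by (metis mult.commute)
  have TQ: "T n \<le> Q a y n" if "0 < b n" "a < y" for n a
    unfolding T_def Q_def
    by (rule integral_mono[OF intT[OF that(1)] intQ[OF that(2)]])
      (simp only: tail[OF that(1)] mult_right_mono[OF ramp_bounds(1)[OF that(2)] g0])
  have QT: "Q y a' n \<le> T n" if "0 < b n" "y < a'" for n a'
    unfolding T_def Q_def
    by (rule integral_mono[OF intQ[OF that(2)] intT[OF that(1)]])
      (simp only: tail[OF that(1)] mult_right_mono[OF ramp_bounds(2)[OF that(2)] g0])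
  have cont: "((\<lambda>a. integral\<^sup>L H g / a\<^sup>2) \<longlongrightarrow> integral\<^sup>L H g / y\<^sup>2) (at y within S)" for S
    using y by (intro tendsto_intros) auto
  have "(\<lambda>n. n * T n) \<longlonglongrightarrow> integral\<^sup>L H g / y\<^sup>2"
  proof (rule order_tendstoI)
    fix z assume z: "z < integral\<^sup>L H g / y\<^sup>2"
    have "\<forall>\<^sub>F a in at_right y. z < integral\<^sup>L H g / a\<^sup>2 \<and> y < a"
      using order_tendstoD(1)[OF cont z] eventually_at_right_less by eventually_elim auto
    then obtain a' where a': "z < integral\<^sup>L H g / a'\<^sup>2" "y < a'"
      using eventually_happens' trivial_limit_at_right_real by blast
    obtain I where I: "(\<lambda>n. n * Q y a' n) \<longlonglongrightarrow> I" "integral\<^sup>L H g / a'\<^sup>2 \<le> I"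
      by (rule ramp_limit[OF y a'(2), folded Q_def])
    have "\<forall>\<^sub>F n in sequentially. z < n * Q y a' n"
      using order_tendstoD(1)[OF I(1)] I(2) a' by simp
    then show "\<forall>\<^sub>F n in sequentially. z < n * T n"
      using b_pos
    proof eventually_elim
      case (elim n)
      then show ?case using mult_left_mono[OF QT[OF elim(2) a'(2)], of n] by simp
    qed
  next
    fix z assume z: "integral\<^sup>L H g / y\<^sup>2 < z"
    have "\<forall>\<^sub>F a in at_left y. integral\<^sup>L H g / a\<^sup>2 < z \<and> a \<in> {0<..<y}"
      using order_tendstoD(2)[OF cont z] eventually_at_left_real[OF y] by eventually_elim auto
    then obtain a where a: "integral\<^sup>L H g / a\<^sup>2 < z" "0 < a" "a < y"
      using eventually_happens' trivial_limit_at_left_real by fastforce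
    obtain I where I: "(\<lambda>n. n * Q a y n) \<longlonglongrightarrow> I" "I \<le> integral\<^sup>L H g / a\<^sup>2"
      by (rule ramp_limit[OF a(2,3), folded Q_def])
    have "\<forall>\<^sub>F n in sequentially. n * Q a y n < z"
      using order_tendstoD(2)[OF I(1)] I(2) a by simp
    then show "\<forall>\<^sub>F n in sequentially. n * T n < z"
      using b_pos
    proof eventually_elim
      case (elim n)
      then show ?case using mult_left_mono[OF TQ[OF elim(2) a(3)], of n] by simp
    qed
  qed
  then show ?thesis unfolding T_def .
qed

end

end

section \<open>Normalized spectral measure and the limit law\<close>

text \<open>For a null \<open>H\<close> the factor is \<open>enn2real\<close> of \<infinity>, hence
  0, and both sides vanish. Nondegeneracy of \<open>H\<close> can therefore be deduced afterwards
  from the positive variance.\<close>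

lemma integral_normalized_spectral:
  assumes g: "g \<in> borel_measurable H" and nonneg: "\<And>x. x \<in> space H \<Longrightarrow> 0 \<le> g x"
  shows "integral\<^sup>L (normalized_spectral H) g = enn2real (1 / emeasure H (space H)) * integral\<^sup>L H g"
proof -
  have "integral\<^sup>L (normalized_spectral H) g = enn2real (\<integral>\<^sup>+x. g x \<partial>normalized_spectral H)"
    using g nonneg
    by (intro integral_eq_nn_integral AE_I2)
      (auto simp: normalized_spectral_def space_scale_measure measurable_cong_sets[OF sets_scale_measure refl])
  also have "(\<integral>\<^sup>+x. g x \<partial>normalized_spectral H) = 1 / emeasure H (space H) * (\<integral>\<^sup>+x. g x \<partial>H)"
    unfolding normalized_spectral_def using g by (intro nn_integral_scale_measure) auto
  also have "enn2real \<dots> = enn2real (1 / emeasure H (space H)) * enn2real (\<integral>\<^sup>+x. g x \<partial>H)"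
    by (rule enn2real_mult)
  also have "enn2real (\<integral>\<^sup>+x. g x \<partial>H) = integral\<^sup>L H g"
    using g nonneg by (intro integral_eq_nn_integral[symmetric] AE_I2) auto
  finally show ?thesis .
qed

lemma real_distribution_normal: "0 < \<sigma> \<Longrightarrow> real_distribution (density lborel (normal_density 0 \<sigma>))"
  using prob_space_normal_density[of \<sigma> 0] by (auto simp: real_distribution_def real_distribution_axioms_def)

lemma char_normal_distribution:
  assumes "0 < \<sigma>"
  shows "char (density lborel (normal_density 0 \<sigma>)) t = of_real (exp (- \<sigma>\<^sup>2 * t\<^sup>2 / 2))"
proof -
  define D where "D = density lborel (\<lambda>x. ennreal (normal_density 0 \<sigma> x))"
  interpret D: prob_space D
    unfolding D_def by (rule prob_space_normal_density[OF assms])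
  have "distributed D lborel (\<lambda>x. x) (normal_density 0 \<sigma>)"
    by (auto simp: distributed_def D_def distr_id2)
  then have "distributed D lborel (\<lambda>x. (x - 0) / \<sigma>) std_normal_density"
    unfolding D.normal_standard_normal_convert[OF assms] .
  moreover have "distr D borel (\<lambda>x. x / \<sigma>) = distr D lborel (\<lambda>x. x / \<sigma>)"
    by (rule distr_cong) auto
  ultimately have std: "distr D borel (\<lambda>x. x / \<sigma>) = std_normal_distribution"
    by (simp add: distributed_def)
  have [measurable]: "(\<lambda>x. x / \<sigma>) \<in> borel_measurable D"
    by (simp add: D_def)
  have "char D t = (\<integral>x. iexp (t * \<sigma> * (x / \<sigma>)) \<partial>D)"
    using assms by (simp add: char_def)
  also have "\<dots> = char (distr D borel (\<lambda>x. x / \<sigma>)) (t * \<sigma>)"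
    unfolding char_def by (subst integral_distr) auto
  also have "\<dots> = of_real (exp (- \<sigma>\<^sup>2 * t\<^sup>2 / 2))"
    unfolding std char_std_normal_distribution by (simp add: power_mult_distrib mult.commute)
  finally show ?thesis unfolding D_def .
qed

text \<open>Take the least point where the distribution function reaches \<open>1 - p\<close>.
  Before it the distribution function is below \<open>1 - p\<close>, hence so is the left limit up
  to equality; any jump over \<open>1 - p\<close> is the atom at this point.\<close>

lemma (in real_distribution) quantile_exists:
  assumes "0 < p" "p < 1"
  shows "\<exists>x. measure M {x<..} \<le> p \<and> p \<le> measure M {x..}"
proof -
  interpret cdf_distribution M ..
  define x where "x = I (1 - p)"
  have inv: "1 - p \<le> cdf M z \<longleftrightarrow> x \<le> z" for z
    unfolding x_def using assms by (intro pseudoinverse) auto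
  have "measure M {x<..} = 1 - cdf M x"
    using prob_compl[of "{..x}"] by (simp add: cdf_def2 Compl_eq_Diff_UNIV[symmetric] Compl_atMost)
  moreover have "1 - p \<le> cdf M x" using inv by simp
  moreover have "measure M {x..} = 1 - measure M {..<x}"
    using prob_compl[of "{..<x}"] by (simp add: Compl_eq_Diff_UNIV[symmetric])
  moreover have "measure M {..<x} \<le> 1 - p"
  proof (rule tendsto_upperbound[OF cdf_at_left])
    have "\<forall>\<^sub>F z in at_left x. z \<in> {x - 1<..<x}" by (rule eventually_at_left_real) simp
    then show "\<forall>\<^sub>F z in at_left x. cdf M z \<le> 1 - p"
    proof eventually_elim
      case (elim z)
      then have "\<not> x \<le> z" by simp
      then show ?case using inv[of z] by linarith
    qed
  qed simp
  ultimately show ?thesis by (intro exI[of _ x]) linarith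
qed

lemma filterlim_nat_div:
  fixes k :: "nat \<Rightarrow> nat"
  assumes small: "(\<lambda>n. real (k n)) \<in> o(\<lambda>n. real n)" and pos: "\<forall>\<^sub>F n in sequentially. 1 \<le> k n"
  shows "filterlim (\<lambda>n. n div k n) at_top sequentially"
  unfolding filterlim_at_top
proof
  fix C :: nat
  have "\<forall>\<^sub>F n in sequentially. norm (real (k n)) \<le> 1 / (C + 1) * norm (real n)"
    by (intro landau_o.smallD[OF small]) simp
  with pos show "\<forall>\<^sub>F n in sequentially. C \<le> n div k n"
  proof eventually_elim
    case (elim n)
    then have "real ((C + 1) * k n) \<le> real n" by (simp add: field_simps)
    then have "C * k n \<le> n" unfolding of_nat_le_iff by simp
    then show ?case using elim by (simp add: less_eq_div_iff_mult_less_eq)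
  qed
qed

text \<open>Regular variation is available along the integers \<open>n div k n\<close>, whereas the
  claims are normalized by \<open>n / k\<close>; this ratio converts one into the other.\<close>

lemma tendsto_real_ratio_nat_div:
  fixes k :: "nat \<Rightarrow> nat"
  assumes "filterlim (\<lambda>n. n div k n) at_top sequentially" and pos: "\<forall>\<^sub>F n in sequentially. 1 \<le> k n"
  shows "(\<lambda>n. real n / real (k n) / real (n div k n)) \<longlonglongrightarrow> 1"
proof (rule tendsto_sandwich)
  have m_pos: "\<forall>\<^sub>F n in sequentially. 1 \<le> n div k n"
    using assms(1) by (simp add: filterlim_at_top)
  have lo: "real (n div k n) \<le> real n / real (k n)" for n
    by (rule of_nat_div_le_of_nat[where 'a=real, simplified]) 
  have up: "real n / real (k n) \<le> real (n div k n) + 1" for n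
    using floor_divide_of_nat_eq[of n "k n", where 'a=real] by linarith
  show "\<forall>\<^sub>F n in sequentially. 1 \<le> real n / real (k n) / real (n div k n)"
    using m_pos by eventually_elim (use lo in \<open>subst pos_le_divide_eq; simp\<close>)
  show "\<forall>\<^sub>F n in sequentially. real n / real (k n) / real (n div k n) \<le> 1 + 1 / real (n div k n)"
    using m_pos by eventually_elim (use up in \<open>subst pos_divide_le_eq; simp add: distrib_right\<close>)
  have "(\<lambda>n. 1 + 1 / real (n div k n)) \<longlonglongrightarrow> 1 + 0"
    by (intro tendsto_intros tendsto_divide_0[OF tendsto_const] filterlim_at_top_imp_at_infinity
        filterlim_compose[OF filterlim_real_sequentially assms(1)])
  then show "(\<lambda>n. 1 + 1 / real (n div k n)) \<longlonglongrightarrow> 1" by simp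
qed simp

text \<open>Off the origin the angle lies on the sphere, where \<open>g\<close> is continuous; the
  origin is a single point and is added separately.\<close>

lemma borel_measurable_comp_angle:
  fixes g :: "real ^ 'd \<Rightarrow> real"
  assumes "continuous_on nonneg_sphere g"
  shows "(\<lambda>x. g (angle x)) \<in> borel_measurable (restrict_space borel nonneg_orthant)"
proof -
  have "(\<lambda>x. indicator nonneg_sphere (angle x) * g (angle x) + indicator {0} x * g 0) \<in> borel_measurable borel"
    by (intro borel_measurable_add borel_measurable_times
        measurable_compose[OF borel_measurable_angle borel_measurable_indicator_nonneg_sphere[OF assms]]) auto
  then have "(\<lambda>x. indicator nonneg_sphere (angle x) * g (angle x) + indicator {0} x * g 0)
      \<in> borel_measurable (restrict_space borel nonneg_orthant)"
    by (rule measurable_restrict_space1)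
  then show ?thesis
  proof (rule measurable_cong[THEN iffD1, rotated])
    fix x :: "real ^ 'd" assume x: "x \<in> space (restrict_space borel nonneg_orthant)"
    have "0 \<notin> (nonneg_sphere :: (real ^ 'd) set)" by (simp add: nonneg_sphere_def)
    moreover have "angle (0 :: real ^ 'd) = 0" by (simp add: angle_def)
    ultimately show "indicator nonneg_sphere (angle x) * g (angle x) + indicator {0} x * g 0 = g (angle x)"
      using x angle_in_nonneg_sphere[of x] by (cases "x = 0") (auto simp: space_restrict_space)
  qed
qed

section \<open>Tail quantities of one observation at intermediate levels\<close>

locale tail_sample = regular_variation M X b H
  for M :: "'w measure" and X :: "'w \<Rightarrow> real ^ 'd" and b :: "nat \<Rightarrow> real" and H :: "(real ^ 'd) measure" +
  fixes k :: "nat \<Rightarrow> nat" and f :: "real ^ 'd \<Rightarrow> real"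
  assumes k_small: "(\<lambda>n. real (k n)) \<in> o(\<lambda>n. real n)"
    and k_inf: "filterlim k at_top sequentially"
    and f_cont: "continuous_on nonneg_sphere f"
    and f_nonneg: "\<And>x. x \<in> nonneg_sphere \<Longrightarrow> 0 \<le> f x"
    and bias: "\<And>K. compact K \<Longrightarrow> K \<subseteq> {0..} \<Longrightarrow>
      uniform_limit K
        (\<lambda>n t. sqrt (real (k n)) *
           (real n / real (k n) *
              expectation (\<lambda>w. f (angle (X w)) * of_bool (ereal (norm (X w)) \<ge> level (b (n div k n)) t))
            - spectral_mean H f * (real n / real (k n)) *
              survival (distr M borel (\<lambda>w. norm (X w))) (level (b (n div k n)) t)))
        (\<lambda>_. 0) sequentially"
    and var_pos: "spectral_var H f > 0"
begin

definition "c = spectral_mean H f"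
definition "h = measure H (space H)"
definition "row_scale n = b (n div k n)"
text \<open>Both versions are kept apart: the estimator counts weak exceedances, while the survival
  function in the bias condition is the strict tail. They differ by the atom of the radius at
  \<open>y\<close>.\<close>

definition "tail_prob y = expectation (\<lambda>w. of_bool (y \<le> norm (X w)) :: real)"
definition "strict_tail_prob y = expectation (\<lambda>w. of_bool (y < norm (X w)) :: real)"
definition "tail_mean y = expectation (\<lambda>w. f (angle (X w)) * of_bool (y \<le> norm (X w)))"
definition "tail_var y = expectation (\<lambda>w. (f (angle (X w)) - c)\<^sup>2 * of_bool (y \<le> norm (X w)))"

text \<open>Positive variance rules out a null \<open>H\<close>, whose normalization would also be
  null. If \<open>c\<close> were 0, nonnegativity of \<open>f\<close> would make it vanish almost
  everywhere, again without variance. Positivity of \<open>c\<close> is what later allows the mass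
  of an atom to be isolated.\<close>

lemma
  shows h_pos: "0 < h" and c_pos: "0 < c"
    and integral_sq: "(\<integral>x. (f x - c)\<^sup>2 \<partial>H) = spectral_var H f * h"
proof -
  interpret H: finite_measure H by (rule finite_H)
  define r where "r = enn2real (1 / emeasure H (space H))"
  have fm: "f \<in> borel_measurable H" by (rule g_measurable_H[OF f_cont f_nonneg])
  have c: "c = r * integral\<^sup>L H f"
    unfolding c_def spectral_mean_def r_def
    by (rule integral_normalized_spectral[OF fm]) (simp add: space_H f_nonneg)
  have v: "spectral_var H f = r * (\<integral>x. (f x - c)\<^sup>2 \<partial>H)"
    unfolding spectral_var_def c_def[unfolded spectral_mean_def, symmetric] r_def
    using fm by (intro integral_normalized_spectral) auto
  have r: "0 < r" using var_pos v enn2real_nonneg[of "1 / emeasure H (space H)"]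
    unfolding r_def by (metis mult_zero_left order_le_less)
  show h: "0 < h"
  proof (rule ccontr)
    assume "\<not> 0 < h"
    then have "emeasure H (space H) = 0"
      unfolding h_def using measure_nonneg[of H "space H"] by (simp add: H.emeasure_eq_measure not_less)
    then show False using r by (simp add: r_def)
  qed
  have "r = 1 / h"
    unfolding r_def H.emeasure_eq_measure h_def[symmetric] using h
    by (metis divide_ennreal enn2real_ennreal ennreal_1 less_imp_le zero_le_divide_1_iff zero_le_one)
  then show "(\<integral>x. (f x - c)\<^sup>2 \<partial>H) = spectral_var H f * h"
    using v h by simp
  have f0: "AE x in H. 0 \<le> f x" using f_nonneg by (intro AE_I2) (simp add: space_H)
  show "0 < c"
  proof (rule ccontr)
    assume "\<not> 0 < c"
    moreover have "0 \<le> integral\<^sup>L H f" using f0 by (rule integral_nonneg_AE)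
    ultimately have i0: "integral\<^sup>L H f = 0" using r c by (simp add: zero_less_mult_iff not_less)
    then have "AE x in H. f x = 0"
      using integral_nonneg_eq_0_iff_AE[OF g_integrable_H[OF f_cont f_nonneg] f0] by simp
    moreover have "c = 0" using c i0 by simp
    ultimately have "AE x in H. (f x - c)\<^sup>2 = 0" by (auto elim: eventually_mono)
    then have "(\<integral>x. (f x - c)\<^sup>2 \<partial>H) = 0" by (rule integral_eq_zero_AE)
    then show False using v var_pos by simp
  qed
qed

lemma k_pos: "\<forall>\<^sub>F n in sequentially. 1 \<le> k n"
  using k_inf by (simp add: filterlim_at_top)

lemma m_at_top: "filterlim (\<lambda>n. n div k n) at_top sequentially"
  by (rule filterlim_nat_div[OF k_small k_pos])

lemma k_le: "\<forall>\<^sub>F n in sequentially. k n \<le> n"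
proof -
  have "\<forall>\<^sub>F n in sequentially. 1 \<le> n div k n"
    using m_at_top by (simp add: filterlim_at_top)
  then show ?thesis by eventually_elim (metis div_less not_le not_one_le_zero)
qed

lemma row_scale_pos: "\<forall>\<^sub>F n in sequentially. 0 < row_scale n"
  unfolding row_scale_def by (rule eventually_compose_filterlim[OF b_pos m_at_top])

lemma tail_limit:
  fixes g :: "real ^ 'd \<Rightarrow> real"
  assumes "continuous_on nonneg_sphere g" "\<And>x. x \<in> nonneg_sphere \<Longrightarrow> 0 \<le> g x" "0 < y"
  shows "(\<lambda>n. n / k n * expectation (\<lambda>w. g (angle (X w)) * of_bool (row_scale n * y \<le> norm (X w)))) \<longlonglongrightarrow> integral\<^sup>L H g / y\<^sup>2"
proof -
  define E where "E n = expectation (\<lambda>w. g (angle (X w)) * of_bool (b n * y \<le> norm (X w)))" for n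
  have "(\<lambda>n. real (n div k n) * E (n div k n)) \<longlonglongrightarrow> integral\<^sup>L H g / y\<^sup>2"
    using filterlim_compose[OF tail_expectation_tendsto[OF assms] m_at_top] unfolding E_def .
  then have "(\<lambda>n. real n / real (k n) / real (n div k n) * (real (n div k n) * E (n div k n))) \<longlonglongrightarrow> 1 * (integral\<^sup>L H g / y\<^sup>2)"
    by (rule tendsto_mult[OF tendsto_real_ratio_nat_div[OF m_at_top k_pos]])
  then have "(\<lambda>n. real n / real (k n) / real (n div k n) * (real (n div k n) * E (n div k n))) \<longlonglongrightarrow> integral\<^sup>L H g / y\<^sup>2"
    by simp
  moreover have "\<forall>\<^sub>F n in sequentially. 1 \<le> n div k n"
    using m_at_top by (simp add: filterlim_at_top)
  ultimately show ?thesis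
    unfolding row_scale_def E_def[symmetric]
    by (rule Lim_transform_eventually[OF _ eventually_mono]) simp
qed

lemma tail_prob_limit: "0 < y \<Longrightarrow> (\<lambda>n. n / k n * tail_prob (row_scale n * y)) \<longlonglongrightarrow> h / y\<^sup>2"
  using tail_limit[of "\<lambda>_. 1" y] by (simp add: tail_prob_def h_def)

lemma tail_var_limit:
  assumes "0 < y"
  shows "(\<lambda>n. n / k n * tail_var (row_scale n * y)) \<longlonglongrightarrow> spectral_var H f * h / y\<^sup>2"
  using tail_limit[of "\<lambda>x. (f x - c)\<^sup>2" y] f_cont assms
  by (simp add: tail_var_def integral_sq continuous_intros)

lemma tail_var_antimono:
  assumes "0 < y" "y \<le> z"
  shows "tail_var z \<le> tail_var y"
proof -
  have "integrable M (\<lambda>w. (f (angle (X w)) - c)\<^sup>2 * of_bool (u \<le> norm (X w)))" if "0 < u" for u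
    using that f_cont by (intro integrable_tail[where g="\<lambda>x. (f x - c)\<^sup>2"]) (auto intro!: continuous_intros)
  then show ?thesis
    unfolding tail_var_def using assms by (intro integral_mono) (auto simp: of_bool_def)
qed

lemma of_bool_integrable[simp]:
  "integrable M (\<lambda>w. of_bool (y \<le> norm (X w)) :: real)" "integrable M (\<lambda>w. of_bool (y < norm (X w)) :: real)"
  by (intro integrable_const_bound[where B=1]; simp)+

lemma tail_prob_antimono: "y \<le> z \<Longrightarrow> tail_prob z \<le> tail_prob y"
  unfolding tail_prob_def by (intro integral_mono of_bool_integrable) (auto simp: of_bool_def)

lemma tail_prob_le_strict: "y < z \<Longrightarrow> tail_prob z \<le> strict_tail_prob y"
  unfolding tail_prob_def strict_tail_prob_def by (intro integral_mono of_bool_integrable) (auto simp: of_bool_def)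

lemma expectation_of_bool:
  assumes "{w \<in> space M. P w} \<in> events"
  shows "expectation (\<lambda>w. of_bool (P w) :: real) = prob {w \<in> space M. P w}"
proof -
  have "expectation (\<lambda>w. of_bool (P w) :: real) = expectation (indicator {w \<in> space M. P w})"
    by (intro Bochner_Integration.integral_cong) (auto simp: indicator_def)
  then show ?thesis using assms by simp
qed

lemma tail_prob_eq: "tail_prob y = measure (distr M borel (\<lambda>w. norm (X w))) {y..}"
proof -
  have "(\<lambda>w. norm (X w)) -` {y..} \<inter> space M = {w \<in> space M. y \<le> norm (X w)}" by auto
  then show ?thesis unfolding tail_prob_def by (subst expectation_of_bool) (auto simp: measure_distr)
qed

lemma strict_tail_prob_eq: "strict_tail_prob y = measure (distr M borel (\<lambda>w. norm (X w))) {y<..}"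
proof -
  have "(\<lambda>w. norm (X w)) -` {y<..} \<inter> space M = {w \<in> space M. y < norm (X w)}" by auto
  then show ?thesis unfolding strict_tail_prob_def by (subst expectation_of_bool) (auto simp: measure_distr)
qed

lemma survival_eq_strict_tail_prob: "survival (distr M borel (\<lambda>w. norm (X w))) (ereal y) = strict_tail_prob y"
proof -
  interpret D: real_distribution "distr M borel (\<lambda>w. norm (X w))" by (rule real_distribution_distr) simp
  show ?thesis
    unfolding survival_ereal strict_tail_prob_eq
    using D.prob_compl[of "{..y}"] by (simp add: cdf_def2 Compl_eq_Diff_UNIV[symmetric] Compl_atMost)
qed

text \<open>The substitution \<open>t = (row_scale n / y)\<^sup>2\<close> turns the levels from
  \<open>row_scale n * \<tau>\<close> upwards into parameters in the compact interval
  \<open>{0..1 / \<tau>\<^sup>2}\<close>. Uniformity there gives one bound for all these levels at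
  once, as needed for levels that move with \<open>n\<close> and for their left neighbours.\<close>

lemma bias_bound:
  assumes \<tau>: "0 < \<tau>" and e: "0 < e"
  shows "\<forall>\<^sub>F n in sequentially. \<forall>y\<ge>row_scale n * \<tau>. n / sqrt (k n) * \<bar>tail_mean y - c * strict_tail_prob y\<bar> < e"
proof -
  have "\<forall>\<^sub>F n in sequentially. \<forall>t\<in>{0..1 / \<tau>\<^sup>2}. dist (sqrt (real (k n)) *
           (real n / real (k n) *
              expectation (\<lambda>w. f (angle (X w)) * of_bool (ereal (norm (X w)) \<ge> level (b (n div k n)) t))
            - spectral_mean H f * (real n / real (k n)) *
              survival (distr M borel (\<lambda>w. norm (X w))) (level (b (n div k n)) t))) 0 < e"
    by (rule uniform_limitD[OF bias e]) auto
  then show ?thesis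
    using row_scale_pos k_pos
  proof eventually_elim
    case (elim n)
    show ?case
    proof (intro allI impI)
      fix y assume y: "row_scale n * \<tau> \<le> y"
      have y0: "0 < y" using y elim(2) \<tau> by (meson less_le_trans mult_pos_pos)
      define t where "t = (row_scale n / y)\<^sup>2"
      have t0: "0 < t" using y0 elim by (simp add: t_def)
      have "row_scale n / y \<le> 1 / \<tau>" using y y0 \<tau> by (simp add: field_simps)
      then have "t \<le> (1 / \<tau>)\<^sup>2" unfolding t_def using y0 elim by (intro power_mono) auto
      then have tin: "t \<in> {0..1 / \<tau>\<^sup>2}" using t0 by (simp add: power_divide)
      have "t powr (- 1 / 2) = y / row_scale n"
        using y0 elim t0 by (simp add: powr_minus_divide powr_half_sqrt t_def)
      then have lev: "level (b (n div k n)) t = ereal y"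
        using t0 elim by (simp add: level_def row_scale_def)
      have "\<bar>sqrt (k n) * (n / k n * tail_mean y - c * (n / k n) * strict_tail_prob y)\<bar> < e"
        using bspec[OF elim(1) tin] unfolding lev survival_eq_strict_tail_prob c_def[symmetric]
        by (simp add: tail_mean_def)
      also have "sqrt (k n) * (n / k n * tail_mean y - c * (n / k n) * strict_tail_prob y)
          = sqrt (k n) / k n * (n * (tail_mean y - c * strict_tail_prob y))"
        by (simp add: right_diff_distrib diff_divide_distrib ac_simps)
      also have "\<dots> = n / sqrt (k n) * (tail_mean y - c * strict_tail_prob y)"
        by (subst sqrt_divide_self_eq) (simp_all add: divide_inverse ac_simps)
      finally show "n / sqrt (k n) * \<bar>tail_mean y - c * strict_tail_prob y\<bar> < e"
        by (simp add: abs_mult)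
    qed
  qed
qed

lemma f_angle_borel[measurable]: "(\<lambda>w. f (angle (X w))) \<in> borel_measurable M"
  by (rule measurable_compose[OF X_measurable borel_measurable_comp_angle[OF f_cont]])

lemma angle_bounded:
  obtains B where "\<And>x. x \<in> nonneg_orthant \<Longrightarrow> \<bar>f (angle x)\<bar> \<le> B"
proof -
  obtain B where B: "\<And>x. x \<in> nonneg_sphere \<Longrightarrow> \<bar>f x\<bar> \<le> B"
    using bounded_on_nonneg_sphere[OF f_cont] by blast
  have "\<bar>f (angle x)\<bar> \<le> max B \<bar>f 0\<bar>" if "x \<in> nonneg_orthant" for x
  proof (cases "x = 0")
    case True
    then show ?thesis by (simp add: angle_def)
  next
    case False
    then show ?thesis using B[OF angle_in_nonneg_sphere[OF that]] by simp
  qed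
  then show ?thesis by (rule that)
qed

text \<open>Letting the level increase to \<open>y\<close> turns the strict exceedance in the survival function into
  a weak one; comparing the two versions bounds the atom of the radius at \<open>y\<close>.\<close>

lemma left_limit:
  assumes "y0 < y" and bound: "\<And>z. y0 \<le> z \<Longrightarrow> a * \<bar>tail_mean z - c * strict_tail_prob z\<bar> \<le> e"
  shows "a * \<bar>tail_mean y - c * tail_prob y\<bar> \<le> e"
proof -
  define d where "d = y - y0"
  define z where "z j = y - d / Suc j" for j :: nat
  have d: "0 < d" using assms by (simp add: d_def)
  have zy: "z j < y" for j using d by (simp add: z_def)
  have zy0: "y0 \<le> z j" for j
  proof -
    have "d / Suc j \<le> d" using d by (simp add: divide_le_eq)
    then show ?thesis by (simp add: z_def d_def)
  qed
  have "(\<lambda>j. d / Suc j) \<longlonglongrightarrow> 0"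
    using LIMSEQ_Suc[OF lim_const_over_n[of d]] by simp
  then have zlim: "z \<longlonglongrightarrow> y"
    unfolding z_def using tendsto_diff[OF tendsto_const[of y]] by fastforce
  have ev: "\<forall>\<^sub>F j in sequentially. (z j \<le> r) = (y \<le> r)" "\<forall>\<^sub>F j in sequentially. (z j < r) = (y \<le> r)" for r
  proof -
    have "\<forall>\<^sub>F j in sequentially. (z j \<le> r) = (y \<le> r) \<and> (z j < r) = (y \<le> r)"
    proof (cases "y \<le> r")
      case True
      then show ?thesis using zy by (auto intro!: always_eventually less_imp_le intro: less_le_trans)
    next
      case False
      then have "\<forall>\<^sub>F j in sequentially. r < z j" by (intro order_tendstoD(1)[OF zlim]) simp
      then show ?thesis by eventually_elim (use False in auto)
    qed
    then show "\<forall>\<^sub>F j in sequentially. (z j \<le> r) = (y \<le> r)" "\<forall>\<^sub>F j in sequentially. (z j < r) = (y \<le> r)"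
      by (auto elim: eventually_mono)
  qed
  obtain B where B: "\<And>x. x \<in> nonneg_orthant \<Longrightarrow> \<bar>f (angle x)\<bar> \<le> B" using angle_bounded by blast
  have B0: "0 \<le> B" using B[of 0] by (auto simp: nonneg_orthant_def)
  have "(\<lambda>j. tail_mean (z j)) \<longlonglongrightarrow> tail_mean y"
    unfolding tail_mean_def
  proof (rule integral_dominated_convergence[where w="\<lambda>_. B"])
    show "AE w in M. (\<lambda>j. f (angle (X w)) * of_bool (z j \<le> norm (X w))) \<longlonglongrightarrow> f (angle (X w)) * of_bool (y \<le> norm (X w))"
      by (intro AE_I2 tendsto_eventually eventually_mono[OF ev(1)]) auto
    show "AE w in M. norm (f (angle (X w)) * of_bool (z j \<le> norm (X w))) \<le> B" for j
      using B[OF X_in_orthant] B0 by (intro AE_I2) (auto simp: of_bool_def)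
  qed auto
  moreover have "(\<lambda>j. strict_tail_prob (z j)) \<longlonglongrightarrow> tail_prob y"
    unfolding strict_tail_prob_def tail_prob_def
  proof (rule integral_dominated_convergence[where w="\<lambda>_. 1"])
    show "AE w in M. (\<lambda>j. of_bool (z j < norm (X w)) :: real) \<longlonglongrightarrow> of_bool (y \<le> norm (X w))"
      by (intro AE_I2 tendsto_eventually eventually_mono[OF ev(2)]) auto
  qed auto
  ultimately have "(\<lambda>j. a * \<bar>tail_mean (z j) - c * strict_tail_prob (z j)\<bar>) \<longlonglongrightarrow> a * \<bar>tail_mean y - c * tail_prob y\<bar>"
    by (intro tendsto_intros)
  then show ?thesis
    by (rule LIMSEQ_le_const2) (use bound zy0 in blast)
qed

text \<open>The level whose expected number of exceedances among \<open>n\<close> observations is \<open>k + s sqrt k\<close>, up to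
  the mass of an atom.\<close>

definition "quantile s n = (SOME x. strict_tail_prob x \<le> (k n + s * sqrt (k n)) / n \<and> (k n + s * sqrt (k n)) / n \<le> tail_prob x)"

section \<open>Location, bias, count and variance at the quantile levels\<close>

lemma relative_rank: "(\<lambda>n. 1 + s / sqrt (k n)) \<longlonglongrightarrow> 1"
proof -
  have "filterlim (\<lambda>n. sqrt (real (k n))) at_top sequentially"
    by (intro filterlim_compose[OF sqrt_at_top] filterlim_compose[OF filterlim_real_sequentially k_inf])
  then have "(\<lambda>n. 1 + s / sqrt (k n)) \<longlonglongrightarrow> 1 + 0"
    by (intro tendsto_intros tendsto_divide_0[OF tendsto_const] filterlim_at_top_imp_at_infinity)
  then show ?thesis by simp
qed

text \<open>A quantile exists once the prescribed probability lies in (0, 1). It is below 1 because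
  \<open>1 + s / sqrt k\<close> drops below 2 while \<open>2 * k\<close> is at most
  \<open>n\<close>, and positive because the same factor tends to 1.\<close>

lemma quantile_spec:
  "\<forall>\<^sub>F n in sequentially. strict_tail_prob (quantile s n) \<le> (k n + s * sqrt (k n)) / n \<and> (k n + s * sqrt (k n)) / n \<le> tail_prob (quantile s n)"
proof -
  interpret D: real_distribution "distr M borel (\<lambda>w. norm (X w))" by (rule real_distribution_distr) simp
  have "\<forall>\<^sub>F n in sequentially. 2 \<le> n div k n"
    using m_at_top by (simp add: filterlim_at_top)
  moreover have "\<forall>\<^sub>F n in sequentially. 0 < 1 + s / sqrt (k n)"
    using order_tendstoD(1)[OF relative_rank, of 0] by simp
  moreover have "\<forall>\<^sub>F n in sequentially. 1 + s / sqrt (k n) < 2"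
    using order_tendstoD(2)[OF relative_rank, of 2] by simp
  ultimately show ?thesis
    using k_pos
  proof eventually_elim
    case (elim n)
    define p where "p = (k n + s * sqrt (k n)) / n"
    have "2 * k n \<le> n" using elim(1,4) by (simp add: less_eq_div_iff_mult_less_eq)
    then have n: "2 * real (k n) \<le> real n" by linarith
    have p: "p = (1 + s / sqrt (k n)) * k n / n"
    proof -
      have "s * real (k n) / sqrt (k n) = s * sqrt (k n)"
        using real_div_sqrt[of "real (k n)"] by (metis of_nat_0_le_iff times_divide_eq_right)
      then show ?thesis by (simp add: p_def distrib_right)
    qed
    have n0: "0 < real n" using n elim(4) by linarith
    have kn0: "0 < real (k n)" using elim(4) by simp
    have "0 < p" unfolding p using elim(2) n0 kn0 by simp
    moreover have "p < 1"
    proof -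
      have "(1 + s / sqrt (k n)) * k n < 2 * real (k n)" using elim(3) kn0 by (intro mult_strict_right_mono) auto
      then show ?thesis unfolding p using n n0 by simp
    qed
    ultimately have "\<exists>y. strict_tail_prob y \<le> p \<and> p \<le> tail_prob y"
      unfolding strict_tail_prob_eq tail_prob_eq by (rule D.quantile_exists)
    then show ?case unfolding quantile_def p_def[symmetric] by (rule someI_ex)
  qed
qed

text \<open>At \<open>row_scale n * sqrt (h / 2)\<close> about \<open>2 * k\<close> exceedances are
  expected, more than the quantile admits, so the quantile is not lower. The strictly smaller factor
  \<open>sqrt h / 2\<close> leaves room below the quantile for the left limit.\<close>

lemma quantile_lower: "\<forall>\<^sub>F n in sequentially. row_scale n * (sqrt h / 2) < quantile s n"
proof -
  have pos: "0 < sqrt (h / 2)" using h_pos by simp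
  have "h / (sqrt (h / 2))\<^sup>2 = 2" using h_pos by simp
  then have "\<forall>\<^sub>F n in sequentially. 3 / 2 < n / k n * tail_prob (row_scale n * sqrt (h / 2))"
    using order_tendstoD(1)[OF tail_prob_limit[OF pos], of "3/2"] by simp
  moreover have "\<forall>\<^sub>F n in sequentially. 1 + s / sqrt (k n) < 3 / 2"
    using order_tendstoD(2)[OF relative_rank, of "3/2"] by simp
  ultimately show ?thesis
    using quantile_spec[of s] k_pos k_le row_scale_pos
  proof eventually_elim
    case (elim n)
    have n0: "0 < real n" "0 < real (k n)" using elim by auto
    have "sqrt h / 2 < sqrt (h / 2)"
      using h_pos by (simp add: real_sqrt_divide field_simps real_sqrt_less_iff[of 2 4, simplified])
    then have lt: "row_scale n * (sqrt h / 2) < row_scale n * sqrt (h / 2)"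
      using elim by simp
    have "row_scale n * sqrt (h / 2) \<le> quantile s n"
    proof (rule ccontr)
      assume "\<not> row_scale n * sqrt (h / 2) \<le> quantile s n"
      then have "tail_prob (row_scale n * sqrt (h / 2)) \<le> (k n + s * sqrt (k n)) / n"
        using tail_prob_le_strict[of "quantile s n" "row_scale n * sqrt (h / 2)"] elim(3) by simp
      then have "n / k n * tail_prob (row_scale n * sqrt (h / 2)) \<le> n / k n * ((k n + s * sqrt (k n)) / n)"
        by (intro mult_left_mono) auto
      also have "\<dots> = 1 + s / sqrt (k n)"
        using n0 by (simp add: field_simps)
      finally show False using elim(1,2) by linarith
    qed
    with lt show ?case by simp
  qed
qed

lemma quantile_pos: "\<forall>\<^sub>F n in sequentially. 0 < quantile s n"
  using quantile_lower[of s] row_scale_pos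
proof eventually_elim
  case (elim n)
  have "0 < row_scale n * (sqrt h / 2)" using elim h_pos by simp
  with elim show ?case by linarith
qed

text \<open>The bias bound holds at the quantile with the strict tail directly, and with the weak
  tail through \<open>left_limit\<close>. The difference of the two is \<open>c\<close> times the
  atom, so division by \<open>c\<close> bounds the latter.\<close>

lemma quantile_bias:
  assumes e: "0 < e"
  shows "\<forall>\<^sub>F n in sequentially. n / sqrt (k n) * \<bar>tail_mean (quantile s n) - c * tail_prob (quantile s n)\<bar> \<le> e \<and>
    n / sqrt (k n) * (tail_prob (quantile s n) - strict_tail_prob (quantile s n)) \<le> 2 * e / c"
proof -
  have "0 < sqrt h / 2" using h_pos by simp
  from bias_bound[OF this e] show ?thesis
    using quantile_lower[of s]
  proof eventually_elim
    case (elim n)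
    define a where "a = n / sqrt (k n)"
    have a: "0 \<le> a" by (simp add: a_def)
    have 1: "a * \<bar>tail_mean (quantile s n) - c * tail_prob (quantile s n)\<bar> \<le> e"
      by (rule left_limit[OF elim(2)]) (use elim(1) in \<open>auto simp: a_def less_imp_le\<close>)
    have 2: "a * \<bar>tail_mean (quantile s n) - c * strict_tail_prob (quantile s n)\<bar> \<le> e"
      using elim by (simp add: a_def less_imp_le)
    have "c * (a * (tail_prob (quantile s n) - strict_tail_prob (quantile s n)))
        = a * (tail_mean (quantile s n) - c * strict_tail_prob (quantile s n)) - a * (tail_mean (quantile s n) - c * tail_prob (quantile s n))"
      by (simp add: algebra_simps)
    also have "\<dots> \<le> a * \<bar>tail_mean (quantile s n) - c * strict_tail_prob (quantile s n)\<bar> + a * \<bar>tail_mean (quantile s n) - c * tail_prob (quantile s n)\<bar>"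
    proof -
      have "a * u - a * v \<le> a * \<bar>u\<bar> + a * \<bar>v\<bar>" for u v
        unfolding right_diff_distrib[symmetric] distrib_left[symmetric] using a by (intro mult_left_mono) auto
      then show ?thesis .
    qed
    also have "\<dots> \<le> 2 * e" using 1 2 by simp
    finally have "a * (tail_prob (quantile s n) - strict_tail_prob (quantile s n)) \<le> 2 * e / c"
      using c_pos by (simp add: field_simps)
    with 1 show ?case by (simp add: a_def)
  qed
qed

text \<open>The prescribed probability lies between the strict and the weak tail at the quantile, so
  the error in the count is at most the scaled mass of the atom.\<close>

lemma quantile_count: "(\<lambda>n. (n * tail_prob (quantile s n) - k n) / sqrt (k n)) \<longlonglongrightarrow> s"
proof (rule tendstoI)
  fix e :: real assume e: "0 < e"
  \<comment> \<open>With this choice the bound \<open>2 * e' / c\<close> on the scaled atom equals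
    \<open>e / 2\<close>.\<close>
  define e' where "e' = e * c / 4"
  have e': "0 < e'" "2 * e' / c < e" using e c_pos by (auto simp: e'_def field_simps)
  show "\<forall>\<^sub>F n in sequentially. dist ((n * tail_prob (quantile s n) - k n) / sqrt (k n)) s < e"
    using quantile_bias[OF e'(1), of s] quantile_spec[of s] k_pos k_le
  proof eventually_elim
    case (elim n)
    define p where "p = (k n + s * sqrt (k n)) / n"
    have n0: "0 < real n" "0 < real (k n)" using elim by auto
    have eq: "(n * tail_prob (quantile s n) - k n) / sqrt (k n) - s = n / sqrt (k n) * (tail_prob (quantile s n) - p)"
      using n0 by (simp add: p_def field_simps)
    have "0 \<le> n / sqrt (k n) * (tail_prob (quantile s n) - p)"
      using elim(2) by (intro mult_nonneg_nonneg) (auto simp: p_def)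
    moreover have "n / sqrt (k n) * (tail_prob (quantile s n) - p) \<le> n / sqrt (k n) * (tail_prob (quantile s n) - strict_tail_prob (quantile s n))"
      using elim(2) by (intro mult_left_mono) (auto simp: p_def)
    ultimately show ?case
      using elim(1) e'(2) unfolding dist_real_def eq by linarith
  qed
qed

lemma quantile_centred: "(\<lambda>n. n * (tail_mean (quantile s n) - c * tail_prob (quantile s n)) / sqrt (k n)) \<longlonglongrightarrow> 0"
proof (rule tendstoI)
  fix e :: real assume e: "0 < e"
  have "0 < e / 2" using e by simp
  from quantile_bias[OF this, of s]
  show "\<forall>\<^sub>F n in sequentially. dist (n * (tail_mean (quantile s n) - c * tail_prob (quantile s n)) / sqrt (k n)) 0 < e"
  proof eventually_elim
    case (elim n)
    have eq: "\<bar>n * (tail_mean (quantile s n) - c * tail_prob (quantile s n)) / sqrt (k n)\<bar> = n / sqrt (k n) * \<bar>tail_mean (quantile s n) - c * tail_prob (quantile s n)\<bar>"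
      by (simp add: abs_mult)
    show ?case unfolding dist_real_def diff_0_right eq using elim e by linarith
  qed
qed

lemma quantile_ratio: "(\<lambda>n. n / k n * tail_prob (quantile s n)) \<longlonglongrightarrow> 1"
proof -
  \<comment> \<open>The factor \<open>1 + 1 / sqrt k - 1\<close> is \<open>1 / sqrt k\<close>,
    written so that \<open>relative_rank\<close> supplies its limit.\<close>
  have "(\<lambda>n. (n * tail_prob (quantile s n) - k n) / sqrt (k n) * (1 + 1 / sqrt (k n) - 1) + 1) \<longlonglongrightarrow> s * (1 - 1) + 1"
    by (intro tendsto_intros quantile_count relative_rank)
  then have "(\<lambda>n. (n * tail_prob (quantile s n) - k n) / sqrt (k n) * (1 + 1 / sqrt (k n) - 1) + 1) \<longlonglongrightarrow> 1" by simp
  then show ?thesis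
  proof (rule Lim_transform_eventually)
    show "\<forall>\<^sub>F n in sequentially. (n * tail_prob (quantile s n) - k n) / sqrt (k n) * (1 + 1 / sqrt (k n) - 1) + 1 = n / k n * tail_prob (quantile s n)"
      using k_pos by eventually_elim (simp add: field_simps)
  qed
qed

text \<open>The expected count is about \<open>k\<close> at the quantile and about
  \<open>k * h / y\<^sup>2\<close> at \<open>row_scale n * y\<close>. Comparing the two by
  monotonicity of the tail locates the quantile at \<open>row_scale n * sqrt h\<close> to first
  order.\<close>

lemma quantile_compare:
  assumes "0 < y"
  shows "sqrt h < y \<Longrightarrow> \<forall>\<^sub>F n in sequentially. quantile s n \<le> row_scale n * y"
    and "y < sqrt h \<Longrightarrow> \<forall>\<^sub>F n in sequentially. row_scale n * y \<le> quantile s n"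
proof -
  define r where "r = h / y\<^sup>2"
  have r: "(\<lambda>n. n / k n * tail_prob (row_scale n * y)) \<longlonglongrightarrow> r"
    unfolding r_def by (rule tail_prob_limit[OF assms])
  have diff: "(\<lambda>n. n / k n * tail_prob (quantile s n) - n / k n * tail_prob (row_scale n * y)) \<longlonglongrightarrow> 1 - r"
    by (intro tendsto_diff quantile_ratio r)
  show "\<forall>\<^sub>F n in sequentially. quantile s n \<le> row_scale n * y" if "sqrt h < y"
  proof -
    have "h < y\<^sup>2" using power_strict_mono[OF that, of 2] h_pos by simp
    then have "r < 1" using assms by (simp add: r_def)
    then have "\<forall>\<^sub>F n in sequentially. 0 < n / k n * tail_prob (quantile s n) - n / k n * tail_prob (row_scale n * y)"
      by (intro order_tendstoD(1)[OF diff]) simp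
    then show ?thesis
    proof eventually_elim
      case (elim n)
      show ?case
      proof (rule ccontr)
        assume "\<not> quantile s n \<le> row_scale n * y"
        then have "n / k n * tail_prob (quantile s n) \<le> n / k n * tail_prob (row_scale n * y)"
          by (intro mult_left_mono tail_prob_antimono) auto
        then show False using elim by simp
      qed
    qed
  qed
  show "\<forall>\<^sub>F n in sequentially. row_scale n * y \<le> quantile s n" if "y < sqrt h"
  proof -
    have "y\<^sup>2 < h" using power_strict_mono[OF that, of 2] h_pos assms by simp
    then have "1 < r" using assms by (simp add: r_def)
    then have "\<forall>\<^sub>F n in sequentially. n / k n * tail_prob (quantile s n) - n / k n * tail_prob (row_scale n * y) < 0"
      by (intro order_tendstoD(2)[OF diff]) simp
    then show ?thesis
    proof eventually_elim
      case (elim n)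
      show ?case
      proof (rule ccontr)
        assume "\<not> row_scale n * y \<le> quantile s n"
        then have "n / k n * tail_prob (row_scale n * y) \<le> n / k n * tail_prob (quantile s n)"
          by (intro mult_left_mono tail_prob_antimono) auto
        then show False using elim by simp
      qed
    qed
  qed
qed

text \<open>The tail variance decreases in the level, so its value at the quantile is squeezed
  between values at \<open>row_scale n * y\<close> with \<open>y\<close> on either side of
  \<open>sqrt h\<close>. Their limits \<open>v * h / y\<^sup>2\<close> approach \<open>v\<close> as
  \<open>y\<close> tends to \<open>sqrt h\<close>.\<close>

lemma quantile_var: "(\<lambda>n. n / k n * tail_var (quantile s n)) \<longlonglongrightarrow> spectral_var H f"
proof -
  define v where "v = spectral_var H f"
  have sh: "0 < sqrt h" using h_pos by simp
  have "((\<lambda>y. v * h / y\<^sup>2) \<longlongrightarrow> v * h / (sqrt h)\<^sup>2) (at (sqrt h) within S)" for S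
    using sh by (intro tendsto_intros) auto
  then have cont: "((\<lambda>y. v * h / y\<^sup>2) \<longlongrightarrow> v) (at (sqrt h) within S)" for S
    using h_pos by simp
  have "(\<lambda>n. n / k n * tail_var (quantile s n)) \<longlonglongrightarrow> v"
  proof (rule order_tendstoI)
    fix z assume z: "z < v"
    have "\<forall>\<^sub>F y in at_right (sqrt h). z < v * h / y\<^sup>2 \<and> sqrt h < y"
      using order_tendstoD(1)[OF cont z] eventually_at_right_less by eventually_elim auto
    then obtain y where y: "z < v * h / y\<^sup>2" "sqrt h < y"
      using eventually_happens' trivial_limit_at_right_real by blast
    have y0: "0 < y" using sh y by linarith
    have "\<forall>\<^sub>F n in sequentially. z < n / k n * tail_var (row_scale n * y)"
      using order_tendstoD(1)[OF tail_var_limit[OF y0]] y(1) by (simp add: v_def)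
    then show "\<forall>\<^sub>F n in sequentially. z < n / k n * tail_var (quantile s n)"
      using quantile_compare(1)[OF y0 y(2), of s] quantile_pos[of s]
    proof eventually_elim
      case (elim n)
      have "n / k n * tail_var (row_scale n * y) \<le> n / k n * tail_var (quantile s n)"
        using elim by (intro mult_left_mono tail_var_antimono) auto
      then show ?case using elim by linarith
    qed
  next
    fix z assume z: "v < z"
    have "\<forall>\<^sub>F y in at_left (sqrt h). v * h / y\<^sup>2 < z \<and> y \<in> {0<..<sqrt h}"
      using order_tendstoD(2)[OF cont z] eventually_at_left_real[OF sh] by eventually_elim auto
    then obtain y where y: "v * h / y\<^sup>2 < z" "0 < y" "y < sqrt h"
      using eventually_happens' trivial_limit_at_left_real by fastforce
    have "\<forall>\<^sub>F n in sequentially. n / k n * tail_var (row_scale n * y) < z"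
      using order_tendstoD(2)[OF tail_var_limit[OF y(2)]] y(1) by (simp add: v_def)
    then show "\<forall>\<^sub>F n in sequentially. n / k n * tail_var (quantile s n) < z"
      using quantile_compare(2)[OF y(2,3), of s] row_scale_pos
    proof eventually_elim
      case (elim n)
      have "n / k n * tail_var (quantile s n) \<le> n / k n * tail_var (row_scale n * y)"
        using elim y by (intro mult_left_mono tail_var_antimono) auto
      then show ?case using elim by linarith
    qed
  qed
  then show ?thesis unfolding v_def .
qed

end

text \<open>Extending \<open>u\<close> by 0 outside \<open>S\<close> expresses the law of
  \<open>u (Y w)\<close> through the Borel law of \<open>Y\<close>, so copies that agree in law on
  the whole space also agree after \<open>u\<close>, which is measurable only on
  \<open>S\<close>.\<close>

lemma distr_comp_restrict_space:
  fixes u :: "'b::topological_space \<Rightarrow> real"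
  assumes S: "S \<in> sets borel" and Y: "Y \<in> M \<rightarrow>\<^sub>M restrict_space borel S"
    and u: "u \<in> borel_measurable (restrict_space borel S)"
  shows "distr M borel (\<lambda>w. u (Y w)) = distr (distr M borel Y) borel (\<lambda>y. indicator S y * u y)"
proof -
  have u': "(\<lambda>y. indicator S y * u y) \<in> borel_measurable borel"
    using u S borel_measurable_restrict_space_iff[of S borel u] by simp
  have Y': "Y \<in> borel_measurable M" "\<And>w. w \<in> space M \<Longrightarrow> Y w \<in> S"
    using Y by (auto simp: measurable_restrict_space2_iff)
  have "distr (distr M borel Y) borel (\<lambda>y. indicator S y * u y) = distr M borel ((\<lambda>y. indicator S y * u y) \<circ> Y)"
    by (rule distr_distr[OF u' Y'(1)])
  also have "\<dots> = distr M borel (\<lambda>w. u (Y w))"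
    using Y'(2) by (intro distr_cong) auto
  finally show ?thesis by simp
qed

theorem theorem4:
  fixes M :: "'w measure"
    and X :: "'w \<Rightarrow> real ^ 'd"
    and Xs :: "nat \<Rightarrow> 'w \<Rightarrow> real ^ 'd"
    and b :: "nat \<Rightarrow> real"
    and H :: "(real ^ 'd) measure"
    and k :: "nat \<Rightarrow> nat"
    and f :: "real ^ 'd \<Rightarrow> real"
  assumes prob: "prob_space M"
    and RV: "regularly_varying2 M X b H"
    and indep: "prob_space.indep_vars M (\<lambda>_. restrict_space borel nonneg_orthant) Xs {1..}"
    and copies: "\<And>l. l \<ge> 1 \<Longrightarrow> distr M borel (Xs l) = distr M borel X"
    and k_small: "(\<lambda>n. real (k n)) \<in> o(\<lambda>n. real n)"
    and k_inf: "filterlim k at_top sequentially"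
    and f_cont: "continuous_on nonneg_sphere f"
    and f_nonneg: "\<And>x. x \<in> nonneg_sphere \<Longrightarrow> 0 \<le> f x"
    and bias: "\<And>K. compact K \<Longrightarrow> K \<subseteq> {0..} \<Longrightarrow>
      uniform_limit K
        (\<lambda>n t. sqrt (real (k n)) *
           (real n / real (k n) *
              prob_space.expectation M (\<lambda>w. f (angle (Xs 1 w)) *
                of_bool (ereal (norm (Xs 1 w)) \<ge> level (b (n div k n)) t))
            - spectral_mean H f * (real n / real (k n)) *
              survival (distr M borel (\<lambda>w. norm (X w))) (level (b (n div k n)) t)))
        (\<lambda>_. 0) sequentially"
    and var_pos: "spectral_var H f > 0"
  shows "weak_conv_m
    (\<lambda>n. distr M borel
       (\<lambda>w. sqrt (real (k n)) * (spectral_mean_estimator f (k n) n (\<lambda>l. Xs l w) - spectral_mean H f)))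
    (density lborel (normal_density 0 (sqrt (spectral_var H f))))"
proof -
  define N where "N = restrict_space borel (nonneg_orthant :: (real ^ 'd) set)"
  define \<phi> where "\<phi> y = f (angle y)" for y
  interpret P: prob_space M by (rule prob)
  interpret regular_variation M X b H by unfold_locales (rule RV)
  have orthant: "nonneg_orthant \<in> sets (borel :: (real ^ 'd) measure)"
    using closed_nonneg_orthant by (rule borel_closed)
  have Xs_meas: "Xs l \<in> M \<rightarrow>\<^sub>M restrict_space borel nonneg_orthant" if "1 \<le> l" for l
    using indep that by (auto simp: P.indep_vars_def)
  have distr_Xs: "distr M borel (\<lambda>w. u (Xs l w)) = distr M borel (\<lambda>w. u (X w))"
    if "1 \<le> l" "u \<in> borel_measurable N" for l and u :: "real ^ 'd \<Rightarrow> real"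
    using that copies[OF that(1)] unfolding N_def
    by (simp add: distr_comp_restrict_space[OF orthant Xs_meas] distr_comp_restrict_space[OF orthant X_measurable])
  interpret S: iid_sample M N Xs
  proof
    show "P.indep_vars (\<lambda>_. N) Xs {1..}" using indep unfolding N_def .
    show "distr M borel (\<lambda>w. u (Xs l w)) = distr M borel (\<lambda>w. u (Xs 1 w))"
      if "1 \<le> l" "u \<in> borel_measurable N" for l and u :: "real ^ 'd \<Rightarrow> real"
      using distr_Xs[OF that] distr_Xs[of 1 u] that by simp
  qed
  have exp_Xs: "P.expectation (\<lambda>w. u (Xs 1 w)) = P.expectation (\<lambda>w. u (X w))"
    if "u \<in> borel_measurable N" for u :: "real ^ 'd \<Rightarrow> real"
  proof -
    have m: "(\<lambda>w. u (Xs 1 w)) \<in> borel_measurable M" "(\<lambda>w. u (X w)) \<in> borel_measurable M"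
      using S.measurable_comp_Xs[OF _ that, of 1] measurable_compose[OF X_measurable, of u borel] that
      by (auto simp: N_def)
    have "P.expectation (\<lambda>w. u (Xs 1 w)) = integral\<^sup>L (distr M borel (\<lambda>w. u (Xs 1 w))) (\<lambda>x. x)"
      using m by (simp add: integral_distr)
    also have "\<dots> = P.expectation (\<lambda>w. u (X w))"
      unfolding distr_Xs[OF order_refl that] using m by (simp add: integral_distr)
    finally show ?thesis .
  qed
  have norm_N[measurable]: "norm \<in> borel_measurable N"
    unfolding N_def by (rule measurable_restrict_space1) simp
  have \<phi>_N[measurable]: "\<phi> \<in> borel_measurable N"
    unfolding \<phi>_def[abs_def] N_def by (rule borel_measurable_comp_angle[OF f_cont])
  interpret tail_sample M X b H k f
  proof
    fix K :: "real set" assume K: "compact K" "K \<subseteq> {0..}"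
    have lev: "(\<lambda>y. \<phi> y * of_bool (a \<le> ereal (norm y))) \<in> borel_measurable N" for a
      by measurable
    show "uniform_limit K
        (\<lambda>n t. sqrt (real (k n)) *
           (real n / real (k n) *
              P.expectation (\<lambda>w. f (angle (X w)) * of_bool (ereal (norm (X w)) \<ge> level (b (n div k n)) t))
            - spectral_mean H f * (real n / real (k n)) *
              survival (distr M borel (\<lambda>w. norm (X w))) (level (b (n div k n)) t)))
        (\<lambda>_. 0) sequentially"
      using bias[OF K] unfolding exp_Xs[OF lev, unfolded \<phi>_def] .
  qed (rule k_small k_inf f_cont f_nonneg var_pos; assumption?)+
  define Kth where "Kth n w = kth_largest (k n) (map (\<lambda>l. norm (Xs l w)) [1..<n + 1])" for n w
  \<comment> \<open>Outside ranks between 1 and \<open>n\<close> the \<open>k\<close>-th largest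
    value is meaningless; the default 0 keeps \<open>Z n\<close> measurable for every
    \<open>n\<close>, as the continuity theorem requires.\<close>
  define Z where "Z n w = (if 1 \<le> k n \<and> k n \<le> n
    then ((\<Sum>l=1..n. \<phi> (Xs l w) * of_bool (Kth n w \<le> norm (Xs l w))) - c * k n) / sqrt (k n) else 0)" for n w
  define \<sigma> where "\<sigma> = sqrt (spectral_var H f)"
  have \<sigma>: "0 < \<sigma>" "\<sigma>\<^sup>2 = spectral_var H f" using var_pos by (auto simp: \<sigma>_def)
  have Z_meas: "Z n \<in> borel_measurable M" for n
  proof (cases "1 \<le> k n \<and> k n \<le> n")
    case True
    then have "(\<lambda>w. \<Sum>l=1..n. \<phi> (Xs l w) * of_bool (Kth n w \<le> norm (Xs l w))) \<in> borel_measurable M"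
      unfolding Kth_def by (intro S.measurable_sum_above_kth_largest) auto
    then show ?thesis using True by (simp add: Z_def[abs_def])
  next
    case False
    then have "Z n = (\<lambda>_. 0)" by (auto simp: Z_def fun_eq_iff)
    then show ?thesis by simp
  qed
  obtain B where B: "\<And>y. y \<in> nonneg_orthant \<Longrightarrow> \<bar>f (angle y)\<bar> \<le> B" using angle_bounded by blast
  have space_N: "space N = nonneg_orthant" by (simp add: N_def space_restrict_space)
  have intf: "integrable M (\<lambda>w. f (angle (X w)) * of_bool (y \<le> norm (X w)))" for y
    using B[OF X_in_orthant]
    by (intro P.integrable_const_bound[where B=B] AE_I2) (auto simp: of_bool_def intro: order_trans[OF abs_ge_zero])
  have char_lim: "(\<lambda>n. char (distr M borel (Z n)) t) \<longlonglongrightarrow> of_real (exp (- spectral_var H f * t\<^sup>2 / 2))" for t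
  proof (rule S.char_sum_above_kth_largest_tendsto[where \<rho>=norm and \<phi>=\<phi> and B=B and x=quantile and c=c, OF norm_N \<phi>_N _ _ k_inf k_le quantile_pos _ _ _ Z_meas])
    show "\<bar>\<phi> y\<bar> \<le> B" if "y \<in> space N" for y
      using B that by (simp add: space_N \<phi>_def)
    show "0 \<le> \<phi> y" if "y \<in> space N" "0 < norm y" for y
      using that angle_in_nonneg_sphere[of y] f_nonneg by (simp add: space_N \<phi>_def)
    have q: "P.expectation (\<lambda>w. of_bool (y \<le> norm (Xs 1 w))) = tail_prob y" for y
      unfolding tail_prob_def by (rule exp_Xs) measurable
    show "(\<lambda>n. (n * P.expectation (\<lambda>w. of_bool (quantile s n \<le> norm (Xs 1 w))) - k n) / sqrt (k n)) \<longlonglongrightarrow> s" for s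
      unfolding q by (rule quantile_count)
    have "P.expectation (\<lambda>w. (\<phi> (Xs 1 w) - c) * of_bool (y \<le> norm (Xs 1 w))) = tail_mean y - c * tail_prob y" for y
    proof -
      have "P.expectation (\<lambda>w. (\<phi> (Xs 1 w) - c) * of_bool (y \<le> norm (Xs 1 w)))
          = P.expectation (\<lambda>w. (\<phi> (X w) - c) * of_bool (y \<le> norm (X w)))"
        by (rule exp_Xs) measurable
      also have "\<dots> = tail_mean y - c * tail_prob y"
        unfolding tail_mean_def tail_prob_def \<phi>_def left_diff_distrib
        using intf by (subst Bochner_Integration.integral_diff) (auto simp del: of_bool_def)
      finally show ?thesis .
    qed
    then show "(\<lambda>n. n * P.expectation (\<lambda>w. (\<phi> (Xs 1 w) - c) * of_bool (quantile s n \<le> norm (Xs 1 w))) / sqrt (k n)) \<longlonglongrightarrow> 0" for s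
      using quantile_centred by simp
    have "P.expectation (\<lambda>w. (\<phi> (Xs 1 w) - c)\<^sup>2 * of_bool (y \<le> norm (Xs 1 w))) = tail_var y" for y
      unfolding tail_var_def \<phi>_def[symmetric] by (rule exp_Xs) measurable
    then show "(\<lambda>n. n * P.expectation (\<lambda>w. (\<phi> (Xs 1 w) - c)\<^sup>2 * of_bool (quantile 0 n \<le> norm (Xs 1 w))) / k n) \<longlonglongrightarrow> spectral_var H f"
      using quantile_var[of 0] by simp
    show "\<forall>\<^sub>F n in sequentially. \<forall>w\<in>space M. Z n w =
      ((\<Sum>l=1..n. \<phi> (Xs l w) * of_bool (kth_largest (k n) (map (\<lambda>l. norm (Xs l w)) [1..<n + 1]) \<le> norm (Xs l w)))
        - c * k n) / sqrt (k n)"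
      using k_pos k_le by eventually_elim (simp add: Z_def Kth_def)
  qed
  have weak: "weak_conv_m (\<lambda>n. distr M borel (Z n)) (density lborel (normal_density 0 \<sigma>))"
    using char_lim
    by (intro levy_continuity P.real_distribution_distr Z_meas real_distribution_normal \<sigma>)
      (simp add: char_normal_distribution[OF \<sigma>(1)] \<sigma>(2))
  \<comment> \<open>Weak convergence concerns limits of distribution functions only, so agreement
    with the normalized estimator for all large \<open>n\<close> is enough.\<close>
  have "\<forall>\<^sub>F n in sequentially. Z n =
      (\<lambda>w. sqrt (real (k n)) * (spectral_mean_estimator f (k n) n (\<lambda>l. Xs l w) - spectral_mean H f))"
    using k_pos k_le
  proof eventually_elim
    case (elim n)
    have eq: "(u - c * k n) / sqrt (k n) = sqrt (k n) * (1 / real (k n) * u - c)" for u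
    proof -
      have "0 < sqrt (k n)" "sqrt (k n) * sqrt (k n) = k n" using elim by auto
      then show ?thesis by (simp add: divide_simps)
    qed
    show ?case
      using elim unfolding Z_def[abs_def] Kth_def spectral_mean_estimator_def eq unfolding \<phi>_def c_def by simp
  qed
  then have "\<forall>\<^sub>F n in sequentially. cdf (distr M borel (Z n)) z = cdf (distr M borel
      (\<lambda>w. sqrt (real (k n)) * (spectral_mean_estimator f (k n) n (\<lambda>l. Xs l w) - spectral_mean H f))) z" for z
    by eventually_elim simp
  from tendsto_cong[OF this] weak show ?thesis
    unfolding weak_conv_m_def weak_conv_def \<sigma>_def by simp
qed

end
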